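(* There is an algorithm on a random access machine which, given $n\in\mathbb{N}$ with $n\ge1$ and $X\in\mathrm{IS}$ with $\mathrm{len}(X)=L(n)$, decides whether $X$ computes $\mathrm{tstnz}_n$ in time $O(n^2)$.
   Context: Basic instructions: $\mathtt{in}{:}i.\mathtt{get}$ ($i\ge1$), $\mathtt{out}.\mathtt{set}{:}b$ ($b\in\{0,1\}$), $\mathtt{aux}{:}i.\mathtt{get}$ ($i\ge1$), $\mathtt{aux}{:}i.\mathtt{set}{:}b$ ($i\ge1$, $b\in\{0,1\}$). The part before the dot names a Boolean register ($\mathtt{in}{:}i$ input, $\mathtt{out}$ output, $\mathtt{aux}{:}i$ auxiliary); $\mathtt{get}$ changes nothing and replies the content, $\mathtt{set}{:}b$ makes the content $b$ and replies $b$. Primitive instructions: for each basic instruction $a$, plain $a$, positive test $+a$, negative test $-a$; forward jumps $\#l$ ($l\in\mathbb{N}$); termination $!$. $\mathrm{IS}$ is the set of finite sequences $X=u_1;\dots;u_k$ of primitive instructions, $\mathrm{len}(X)=k$. Execution starts at $u_1$: plain $a$ executes $a$ and proceeds with the next instruction; $+a$ executes $a$ and proceeds with the next instruction if the reply is $1$, otherwise skips the next one and proceeds with the one after it; $-a$ likewise with replies reversed; $\#l$ proceeds with the $l$-th next instruction; $!$ terminates. If $l=0$ or there is no instruction to proceed with, execution never terminates. For $f:\{0,1\}^n\to\{0,1\}$, $X$ computes $f$ if there is $k$ such that for all $b_1,\dots,b_n$, executing $X$ with $\mathtt{in}{:}i$ initially $b_i$, $\mathtt{out}$ and $\mathtt{aux}{:}1,\dots,\mathtt{aux}{:}k$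 initially $0$ (other registers arbitrary) terminates with final content of $\mathtt{out}$ equal to $f(b_1,\dots,b_n)$. $\mathrm{tstnz}_n(b_1,\dots,b_n)=1$ iff some $b_i=1$. $L(n)=3n/2+1$ for even $n$, $3(n+1)/2$ for odd $n$. Model: random access machine in the sense of Cook and Reckhow (without multiplication/division), uniform cost criterion; each primitive instruction of the input is represented by two integers (its form and its natural-number parameter, or $-1$ if none). *)

theory Defs
  imports Complex_Main "HOL-Library.Landau_Symbols"
begin

section \<open>Instruction sequences\<close>

datatype basic =
    InGet nat
  | OutSet bool
  | AuxGet nat
  | AuxSet nat bool

datatype prim =
    Plain basic
  | PosTest basic
  | NegTest basic
  | Jump nat
  | Term

text \<open>Input and auxiliary registers are numbered from 1.\<close>

fun valid_basic :: "basic \<Rightarrow> bool" where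
  "valid_basic (InGet i) = (1 \<le> i)"
| "valid_basic (OutSet b) = True"
| "valid_basic (AuxGet i) = (1 \<le> i)"
| "valid_basic (AuxSet i b) = (1 \<le> i)"

fun valid_prim :: "prim \<Rightarrow> bool" where
  "valid_prim (Plain a) = valid_basic a"
| "valid_prim (PosTest a) = valid_basic a"
| "valid_prim (NegTest a) = valid_basic a"
| "valid_prim (Jump l) = True"
| "valid_prim Term = True"

definition IS :: "prim list set" where
  "IS = {X. X \<noteq> [] \<and> (\<forall>u \<in> set X. valid_prim u)}"

datatype reg = InReg nat | OutReg | AuxReg nat

type_synonym store = "reg \<Rightarrow> bool"

fun reply :: "basic \<Rightarrow> store \<Rightarrow> bool" where
  "reply (InGet i) s = s (InReg i)"
| "reply (OutSet b) s = b"
| "reply (AuxGet i) s = s (AuxReg i)"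
| "reply (AuxSet i b) s = b"

fun effect :: "basic \<Rightarrow> store \<Rightarrow> store" where
  "effect (InGet i) s = s"
| "effect (OutSet b) s = s(OutReg := b)"
| "effect (AuxGet i) s = s"
| "effect (AuxSet i b) s = s(AuxReg i := b)"

text \<open>\<open>exec X p s s'\<close>: execution of \<open>X\<close> from the instruction at position \<open>p\<close>
  (counted from 0) in store \<open>s\<close> terminates with final store \<open>s'\<close>. There is no rule for
  a position outside \<open>X\<close>, and \<open>Jump 0\<close> only leads back to itself, so in these two cases
  there is no terminating execution.\<close>

inductive exec :: "prim list \<Rightarrow> nat \<Rightarrow> store \<Rightarrow> store \<Rightarrow> bool" for X where
  exec_Term: "\<lbrakk>p < length X; X ! p = Term\<rbrakk> \<Longrightarrow> exec X p s s"
| exec_Plain: "\<lbrakk>p < length X; X ! p = Plain a; exec X (p + 1) (effect a s) s'\<rbrakk>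
    \<Longrightarrow> exec X p s s'"
| exec_PosTest: "\<lbrakk>p < length X; X ! p = PosTest a;
    exec X (if reply a s then p + 1 else p + 2) (effect a s) s'\<rbrakk> \<Longrightarrow> exec X p s s'"
| exec_NegTest: "\<lbrakk>p < length X; X ! p = NegTest a;
    exec X (if reply a s then p + 2 else p + 1) (effect a s) s'\<rbrakk> \<Longrightarrow> exec X p s s'"
| exec_Jump: "\<lbrakk>p < length X; X ! p = Jump l; exec X (p + l) s s'\<rbrakk> \<Longrightarrow> exec X p s s'"

text \<open>A function on \<open>{0,1}\<^sup>n\<close> is given by its values on Boolean lists of length \<open>n\<close>;
  the element at list position \<open>i - 1\<close> is the argument \<open>b\<^sub>i\<close>.\<close>

definition computes :: "prim list \<Rightarrow> nat \<Rightarrow> (bool list \<Rightarrow> bool) \<Rightarrow> bool" where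
  "computes X n f \<longleftrightarrow>
    (\<exists>k. \<forall>bs s. length bs = n \<and> (\<forall>i \<in> {1..n}. s (InReg i) = bs ! (i - 1)) \<and>
       s OutReg = False \<and> (\<forall>i \<in> {1..k}. s (AuxReg i) = False) \<longrightarrow>
       (\<exists>s'. exec X 0 s s' \<and> s' OutReg = f bs))"

definition tstnz :: "bool list \<Rightarrow> bool" where
  "tstnz bs \<longleftrightarrow> (\<exists>b \<in> set bs. b = True)"

definition L :: "nat \<Rightarrow> nat" where
  "L n = (if even n then 3 * n div 2 + 1 else 3 * (n + 1) div 2)"


section \<open>Random access machines\<close>

text \<open>The instruction set of Cook and Reckhow: \<open>X\<^sub>i \<leftarrow> C\<close>, \<open>X\<^sub>i \<leftarrow> X\<^sub>j + X\<^sub>k\<close>,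
  \<open>X\<^sub>i \<leftarrow> X\<^sub>j - X\<^sub>k\<close>, \<open>X\<^sub>i \<leftarrow> X\<^bsub>X\<^sub>j\<^esub>\<close>, \<open>X\<^bsub>X\<^sub>i\<^esub> \<leftarrow> X\<^sub>j\<close>, \<open>TRA m if X\<^sub>j > 0\<close>,
  \<open>READ X\<^sub>i\<close>, \<open>PRINT X\<^sub>i\<close>.\<close>

datatype ram_instr =
    RConst nat int
  | RAdd nat nat nat
  | RSub nat nat nat
  | RLoad nat nat
  | RStore nat nat
  | RTra nat nat
  | RRead nat
  | RPrint nat

type_synonym ram_program = "ram_instr list"

record ram_config =
  ram_pc :: nat
  ram_mem :: "nat \<Rightarrow> int"
  ram_inp :: "int list"
  ram_out :: "int list"

text \<open>Effect of one instruction, in particular on the program counter (lines are counted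
  from 0). The result \<open>None\<close> means that the instruction cannot be executed: a
  negative register address, or no input left to read.\<close>

fun ram_exec :: "ram_instr \<Rightarrow> ram_config \<Rightarrow> ram_config option" where
  "ram_exec (RConst i c) \<sigma> =
     Some (\<sigma>\<lparr>ram_pc := ram_pc \<sigma> + 1, ram_mem := (ram_mem \<sigma>)(i := c)\<rparr>)"
| "ram_exec (RAdd i j k) \<sigma> =
     Some (\<sigma>\<lparr>ram_pc := ram_pc \<sigma> + 1,
             ram_mem := (ram_mem \<sigma>)(i := ram_mem \<sigma> j + ram_mem \<sigma> k)\<rparr>)"
| "ram_exec (RSub i j k) \<sigma> =
     Some (\<sigma>\<lparr>ram_pc := ram_pc \<sigma> + 1,
             ram_mem := (ram_mem \<sigma>)(i := ram_mem \<sigma> j - ram_mem \<sigma> k)\<rparr>)"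
| "ram_exec (RLoad i j) \<sigma> =
     (if ram_mem \<sigma> j < 0 then None
      else Some (\<sigma>\<lparr>ram_pc := ram_pc \<sigma> + 1,
                   ram_mem := (ram_mem \<sigma>)(i := ram_mem \<sigma> (nat (ram_mem \<sigma> j)))\<rparr>))"
| "ram_exec (RStore i j) \<sigma> =
     (if ram_mem \<sigma> i < 0 then None
      else Some (\<sigma>\<lparr>ram_pc := ram_pc \<sigma> + 1,
                   ram_mem := (ram_mem \<sigma>)(nat (ram_mem \<sigma> i) := ram_mem \<sigma> j)\<rparr>))"
| "ram_exec (RTra m j) \<sigma> =
     Some (\<sigma>\<lparr>ram_pc := (if ram_mem \<sigma> j > 0 then m else ram_pc \<sigma> + 1)\<rparr>)"
| "ram_exec (RRead i) \<sigma> =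
     (case ram_inp \<sigma> of
        [] \<Rightarrow> None
      | x # xs \<Rightarrow> Some (\<sigma>\<lparr>ram_pc := ram_pc \<sigma> + 1,
                          ram_mem := (ram_mem \<sigma>)(i := x), ram_inp := xs\<rparr>))"
| "ram_exec (RPrint i) \<sigma> =
     Some (\<sigma>\<lparr>ram_pc := ram_pc \<sigma> + 1, ram_out := ram_out \<sigma> @ [ram_mem \<sigma> i]\<rparr>)"

definition ram_step :: "ram_program \<Rightarrow> ram_config \<Rightarrow> ram_config option" where
  "ram_step P \<sigma> = (if ram_pc \<sigma> < length P then ram_exec (P ! ram_pc \<sigma>) \<sigma> else None)"

fun ram_steps :: "ram_program \<Rightarrow> nat \<Rightarrow> ram_config \<Rightarrow> ram_config option" where
  "ram_steps P 0 \<sigma> = Some \<sigma>"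
| "ram_steps P (Suc t) \<sigma> = Option.bind (ram_step P \<sigma>) (ram_steps P t)"

definition ram_init :: "int list \<Rightarrow> ram_config" where
  "ram_init xs = \<lparr>ram_pc = 0, ram_mem = (\<lambda>_. 0), ram_inp = xs, ram_out = []\<rparr>"

text \<open>Time is the number of executed instructions (uniform cost criterion). A machine
  halts when control reaches a line that is not in the program; getting stuck at an
  instruction that cannot be executed is not halting.\<close>

definition ram_outputs_in_time ::
  "ram_program \<Rightarrow> int list \<Rightarrow> nat \<Rightarrow> int list \<Rightarrow> bool" where
  "ram_outputs_in_time P xs T ys \<longleftrightarrow>
    (\<exists>t \<sigma>. t \<le> T \<and> ram_steps P t (ram_init xs) = Some \<sigma> \<and>
       length P \<le> ram_pc \<sigma> \<and> ram_out \<sigma> = ys)"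


section \<open>Representation of the input\<close>

text \<open>The form of an instruction is everything but its natural-number parameter; in
  particular the Boolean of a set instruction belongs to the form.\<close>

fun basic_form :: "basic \<Rightarrow> int" where
  "basic_form (InGet i) = 0"
| "basic_form (OutSet b) = (if b then 2 else 1)"
| "basic_form (AuxGet i) = 3"
| "basic_form (AuxSet i b) = (if b then 5 else 4)"

fun basic_param :: "basic \<Rightarrow> int" where
  "basic_param (InGet i) = int i"
| "basic_param (OutSet b) = - 1"
| "basic_param (AuxGet i) = int i"
| "basic_param (AuxSet i b) = int i"

fun prim_form :: "prim \<Rightarrow> int" where
  "prim_form (Plain a) = basic_form a"
| "prim_form (PosTest a) = 6 + basic_form a"
| "prim_form (NegTest a) = 12 + basic_form a"
| "prim_form (Jump l) = 18"
| "prim_form Term = 19"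

fun prim_param :: "prim \<Rightarrow> int" where
  "prim_param (Plain a) = basic_param a"
| "prim_param (PosTest a) = basic_param a"
| "prim_param (NegTest a) = basic_param a"
| "prim_param (Jump l) = int l"
| "prim_param Term = - 1"

definition encode_input :: "nat \<Rightarrow> prim list \<Rightarrow> int list" where
  "encode_input n X = int n # concat (map (\<lambda>u. [prim_form u, prim_param u]) X)"

end

theory Submission
  imports Defs
begin

text \<open>For \<open>X\<close> of length \<open>L n\<close> it suffices to run \<open>X\<close> on \<open>O(n)\<close> inputs; each run takes \<open>O(n)\<close> steps
  because all jumps are forward.

  Suppose that \<open>X\<close> is correct on the zero vector and on the unit vectors. On the zero vector every
  input has a decisive test, and the branch taken on 1 requires a further instruction; two tests can
  share one only in the form \<open>-in:a; +in:b; e\<close>. Counting shows that length \<open>L n\<close> leaves no freedom: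
  \<open>X\<close> consists of such blocks, of one shorter block \<open>+in:a; e\<close> if \<open>n\<close> is odd, and of a final \<open>!\<close>.
  Correctness on the unit vectors makes every \<open>e\<close> set the output register to 1 or jump to a later
  \<open>e\<close>, with one exception: the \<open>e\<close> in front of the short block may be a test that skips to the \<open>e\<close>
  of the short block. If it is \<open>+in:c\<close>, the unit vectors do not suffice, but adding the sums of the
  unit vectors with the \<open>c\<close>-th one does.\<close>

section \<open>Instruction sequences\<close>

text \<open>Why so few vectors suffice: every \<open>e\<close> except the exceptional one leads to
  output 1 whatever the store is, by setting \<open>out\<close> or by jumping to a later
  \<open>e\<close>, and a decisive test reads only its own input. At the exceptional
  \<open>e\<close> a set instruction has a constant reply and a tested auxiliary register can be
  required to be 0 initially, so only reading an input can tell a store from a unit vector. A test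
  \<open>-in:c\<close> skips on the \<open>i\<close>-th unit vector only for \<open>c = i\<close>,
  and then it skips on every store with \<open>in:i\<close> set. But \<open>+in:c\<close> skips on 0
  and falls through on 1, a branch that unit vectors may leave unexplored. Here \<open>c\<close> may
  even exceed \<open>n\<close>; \<open>X\<close> is then wrong, because registers beyond
  \<open>n\<close> are arbitrary, and the extra vectors detect this too.

  Two obstacles shape the machine. Register numbers in the input are unbounded, so registers cannot
  be cleared by a sweep between runs; stamps replace the clearing. And \<open>c\<close> has to be
  found with constant work per instruction, which the sums of adjacent forms make possible without
  analysing blocks.\<close>

fun next_state :: "prim \<Rightarrow> nat \<times> store \<Rightarrow> nat \<times> store" where
  "next_state (Plain a) (p, s) = (p + 1, effect a s)"
| "next_state (PosTest a) (p, s) = (if reply a s then p + 1 else p + 2, effect a s)"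
| "next_state (NegTest a) (p, s) = (if reply a s then p + 2 else p + 1, effect a s)"
| "next_state (Jump l) (p, s) = (p + l, s)"
| "next_state Term (p, s) = (p, s)"

lemma exec_unfold:
  "exec X p s s' \<longleftrightarrow> p < length X \<and>
     (if X ! p = Term then s' = s
      else exec X (fst (next_state (X ! p) (p, s))) (snd (next_state (X ! p) (p, s))) s')"
proof (cases "X ! p")
  case (Plain a) then show ?thesis by (subst exec.simps) auto
next
  case (PosTest a) then show ?thesis by (subst exec.simps) auto
next
  case (NegTest a) then show ?thesis by (subst exec.simps) auto
next
  case (Jump l) then show ?thesis by (subst exec.simps) auto
next
  case Term then show ?thesis by (subst exec.simps) auto
qed

lemma exec_length: "exec X p s s' \<Longrightarrow> p < length X"
  using exec_unfold by blast

lemma exec_deterministic: "exec X p s s' \<Longrightarrow> exec X p s s'' \<Longrightarrow> s' = s''"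
proof (induction rule: exec.induct)
  case (exec_Term p s) then show ?case by (simp add: exec_unfold[of X p])
next
  case (exec_Plain p a s s') then show ?case by (simp add: exec_unfold[of X p])
next
  case (exec_PosTest p a s s') then show ?case by (simp add: exec_unfold[of X p] split: if_splits)
next
  case (exec_NegTest p a s s') then show ?case by (simp add: exec_unfold[of X p] split: if_splits)
next
  case (exec_Jump p l s s') then show ?case by (simp add: exec_unfold[of X p])
qed

text \<open>A derivation is finite, and for \<open>Jump 0\<close> the premise would be the
  conclusion itself.\<close>

lemma exec_not_Jump_0: "exec X p s s' \<Longrightarrow> X ! p \<noteq> Jump 0"
  by (induction rule: exec.induct) (auto intro!: gr0I)

lemma next_state_progress:
  assumes "exec X p s s'" "X ! p \<noteq> Term"
  shows "p < fst (next_state (X ! p) (p, s))"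
  using assms exec_not_Jump_0[OF assms(1)] by (cases "X ! p") auto

text \<open>An inductive derivation has no time axis. The counting argument compares positions at
  different times and takes the last time with some property, so the run is unrolled into functions
  of an index.\<close>

lemma exec_trace:
  assumes "exec X p s s'"
  shows "\<exists>T ps ss. ps 0 = p \<and> ss 0 = s \<and> ss T = s' \<and> ps T < length X \<and> X ! ps T = Term \<and>
    (\<forall>k<T. X ! ps k \<noteq> Term \<and> ps k < ps (Suc k) \<and>
       next_state (X ! ps k) (ps k, ss k) = (ps (Suc k), ss (Suc k)))"
proof -
  have step: "\<exists>T ps ss. ps 0 = p \<and> ss 0 = s \<and> ss T = s' \<and> ps T < length X \<and> X ! ps T = Term \<and>
      (\<forall>k<T. X ! ps k \<noteq> Term \<and> ps k < ps (Suc k) \<and>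
         next_state (X ! ps k) (ps k, ss k) = (ps (Suc k), ss (Suc k)))"
    if ex: "exec X p s s'" and nt: "X ! p \<noteq> Term" and n: "next_state (X ! p) (p, s) = (p1, s1)"
      and IH: "\<exists>T ps ss. ps 0 = p1 \<and> ss 0 = s1 \<and> ss T = s' \<and> ps T < length X \<and> X ! ps T = Term \<and>
      (\<forall>k<T. X ! ps k \<noteq> Term \<and> ps k < ps (Suc k) \<and>
         next_state (X ! ps k) (ps k, ss k) = (ps (Suc k), ss (Suc k)))" for p s s' p1 s1
  proof -
    obtain T ps ss where *: "ps 0 = p1" "ss 0 = s1" "ss T = s'" "ps T < length X" "X ! ps T = Term"
      "\<And>k. k < T \<Longrightarrow> X ! ps k \<noteq> Term \<and> ps k < ps (Suc k) \<and>
         next_state (X ! ps k) (ps k, ss k) = (ps (Suc k), ss (Suc k))" using IH by blast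
    have "p < p1" using next_state_progress[OF ex nt] n by simp
    then show ?thesis using * nt n
      by (intro exI[of _ "Suc T"] exI[of _ "case_nat p ps"] exI[of _ "case_nat s ss"])
         (auto simp: less_Suc_eq_0_disj)
  qed
  show ?thesis using assms
  proof (induction rule: exec.induct)
    case (exec_Term p s)
    then show ?case by (intro exI[of _ 0] exI[of _ "\<lambda>_. p"] exI[of _ "\<lambda>_. s"]) auto
  next
    case (exec_Plain p a s s')
    show ?case by (rule step[OF exec.exec_Plain[OF exec_Plain(1-3)] _ _ exec_Plain(4)])
      (use exec_Plain in auto)
  next
    case (exec_PosTest p a s s')
    show ?case by (rule step[OF exec.exec_PosTest[OF exec_PosTest(1-3)] _ _ exec_PosTest(4)])
      (use exec_PosTest in auto)
  next
    case (exec_NegTest p a s s')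
    show ?case by (rule step[OF exec.exec_NegTest[OF exec_NegTest(1-3)] _ _ exec_NegTest(4)])
      (use exec_NegTest in auto)
  next
    case (exec_Jump p l s s')
    show ?case by (rule step[OF exec.exec_Jump[OF exec_Jump(1-3)] _ _ exec_Jump(4)])
      (use exec_Jump in auto)
  qed
qed

lemma effect_InReg [simp]: "effect a s (InReg j) = s (InReg j)"
  by (cases a) auto

lemma next_state_InReg: "next_state u (p, s) = (p', s') \<Longrightarrow> s' (InReg j) = s (InReg j)"
  by (cases u) auto

text \<open>Only a test of \<open>in:i\<close> makes control depend on it:
  \<open>Plain (InGet i)\<close> discards the reply, and no instruction writes an input
  register.\<close>

lemma next_state_upd_InReg:
  assumes "u \<noteq> PosTest (InGet i)" "u \<noteq> NegTest (InGet i)" "next_state u (p, s) = (p', s')"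
  shows "next_state u (p, s(InReg i := b)) = (p', s'(InReg i := b))"
proof -
  have e: "effect a (s(InReg i := b)) = (effect a s)(InReg i := b)" for a
    by (cases a) (auto simp: fun_upd_twist)
  have r: "a \<noteq> InGet i \<Longrightarrow> reply a (s(InReg i := b)) = reply a s" for a
    by (cases a) auto
  show ?thesis using assms r by (cases u) (auto simp: e)
qed

definition yields :: "prim list \<Rightarrow> nat \<Rightarrow> store \<Rightarrow> bool \<Rightarrow> bool" where
  "yields X p s b \<longleftrightarrow> (\<exists>s'. exec X p s s' \<and> s' OutReg = b)"

lemma yields_length: "yields X p s b \<Longrightarrow> p < length X"
  using exec_length unfolding yields_def by blast

lemma yields_unique: "yields X p s b \<Longrightarrow> exec X p s s' \<Longrightarrow> s' OutReg = b"
  using exec_deterministic unfolding yields_def by blast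

lemma yields_step:
  "X ! p \<noteq> Term \<Longrightarrow> next_state (X ! p) (p, s) = (p', s') \<Longrightarrow>
    yields X p s b \<longleftrightarrow> p < length X \<and> yields X p' s' b"
  unfolding yields_def by (subst exec_unfold) auto

text \<open>Index 0 stands for no input, as inputs are numbered from 1:
  \<open>test_store 0 0\<close> is the zero vector, \<open>test_store i 0\<close> a unit
  vector.\<close>

definition test_store :: "nat \<Rightarrow> nat \<Rightarrow> store" where
  "test_store i c r = (case r of InReg j \<Rightarrow> 0 < j \<and> (j = i \<or> j = c) | _ \<Rightarrow> False)"

lemma test_store_simps [simp]:
  "test_store i c (InReg j) \<longleftrightarrow> 0 < j \<and> (j = i \<or> j = c)"
  "\<not> test_store i c OutReg" "\<not> test_store i c (AuxReg j)"
  by (simp_all add: test_store_def)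

lemma test_store_upd: "i \<noteq> 0 \<Longrightarrow> (test_store 0 0)(InReg i := True) = test_store i 0"
  by (rule ext) (auto simp: test_store_def split: reg.splits)

text \<open>The summands match the later count: \<open>n\<close> decisive tests, half as many owned
  instructions rounded up, and the final \<open>!\<close>.\<close>

lemma L_eq: "L n = n + (n + 1) div 2 + 1"
  unfolding L_def by (cases "even n") (auto elim!: evenE oddE)

subsection \<open>The block structure forced by minimal length\<close>

text \<open>In terms of blocks: \<open>-in:a; +in:b; e\<close> (two inputs) or \<open>+in:a; e\<close> (one input), followed by
  a final \<open>!\<close>. \<open>r i\<close> is the position of the decisive test of \<open>in:i\<close>, \<open>E\<close> the set of positions of
  the instructions \<open>e\<close>. By \<open>skip_unique\<close> at most one \<open>e\<close> is directly followed by a one-input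
  block; only this \<open>e\<close> can skip into another \<open>e\<close>.\<close>

locale block_structure =
  fixes X :: "prim list" and n :: nat and r :: "nat \<Rightarrow> nat" and E :: "nat set" and \<tau> :: nat
  assumes cover: "{..<length X} = r ` {1..n} \<union> E \<union> {\<tau>}"
    and disjoint: "r ` {1..n} \<inter> E = {}" "\<tau> \<notin> E" "\<tau> \<notin> r ` {1..n}"
    and len: "length X = Suc \<tau>"
    and Term: "X ! \<tau> = Term"
    and inj: "inj_on r {1..n}"
    and reads: "i \<in> {1..n} \<Longrightarrow>
        X ! r i = PosTest (InGet i) \<and> r i + 1 \<in> E \<and> r i + 2 \<in> r ` {1..n} \<union> {\<tau>} \<or>
        X ! r i = NegTest (InGet i) \<and> r i + 1 \<in> r ` {1..n} \<and> r i + 2 \<in> E"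
    and E_pred: "q \<in> E \<Longrightarrow> \<exists>i \<in> {1..n}. q = r i + 1 \<and> X ! r i = PosTest (InGet i)"
    and skip_unique: "\<lbrakk>q \<in> E; q + 2 \<in> E; q' \<in> E; q' + 2 \<in> E\<rbrakk> \<Longrightarrow> q = q'"
    and E_succ: "q \<in> E \<Longrightarrow> q + 1 \<in> r ` {1..n} \<union> {\<tau>}"
    and start: "0 \<in> r ` {1..n} \<union> {\<tau>}"

locale passing =
  fixes X :: "prim list" and n :: nat
  assumes len: "length X = L n"
    and zero: "yields X 0 (test_store 0 0) False"
    and unit: "i \<in> {1..n} \<Longrightarrow> yields X 0 (test_store i 0) True"

section \<open>Decisive tests on the run for the zero vector\<close>

locale zero_trace = passing +
  fixes T :: nat and ps :: "nat \<Rightarrow> nat" and ss :: "nat \<Rightarrow> store"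
  assumes ps0: "ps 0 = 0" and ss0: "ss 0 = test_store 0 0"
    and outT: "\<not> ss T OutReg" and psT: "ps T < length X" and TermT: "X ! ps T = Term"
    and noTerm: "k < T \<Longrightarrow> X ! ps k \<noteq> Term"
    and ps_less: "k < T \<Longrightarrow> ps k < ps (Suc k)"
    and next_state_trace: "k < T \<Longrightarrow> next_state (X ! ps k) (ps k, ss k) = (ps (Suc k), ss (Suc k))"
begin

lemma ps_strict: "k < l \<Longrightarrow> l \<le> T \<Longrightarrow> ps k < ps l"
proof (induction l)
  case (Suc l)
  then show ?case using ps_less[of l] by (cases "k = l") auto
qed simp

lemma ps_mono: "k \<le> l \<Longrightarrow> l \<le> T \<Longrightarrow> ps k \<le> ps l"
  using ps_strict[of k l] by (cases "k = l") auto

lemma ps_inj: "k \<le> T \<Longrightarrow> l \<le> T \<Longrightarrow> ps k = ps l \<Longrightarrow> k = l"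
  using ps_strict[of k l] ps_strict[of l k] by (cases k l rule: linorder_cases) auto

lemma ps_less_imp: "k \<le> T \<Longrightarrow> l \<le> T \<Longrightarrow> ps k < ps l \<Longrightarrow> k < l"
  using ps_mono[of l k] by (cases "k < l") auto

lemma ps_gap: "k < T \<Longrightarrow> l \<le> T \<Longrightarrow> ps k < ps l \<Longrightarrow> ps (Suc k) \<le> ps l"
  using ps_less_imp[of k l] ps_mono[of "Suc k" l] by auto

lemma ss_InReg: "k \<le> T \<Longrightarrow> \<not> ss k (InReg j)"
proof (induction k)
  case 0 then show ?case by (auto simp: ss0)
next
  case (Suc k) then show ?case using next_state_InReg[OF next_state_trace[of k]] by auto
qed

definition vis :: "nat set" where "vis = ps ` {..T}"

text \<open>\<open>r i\<close> is the last position of the all-zero run at which flipping \<open>in:i\<close> still leads to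
  output 1.\<close>

definition flips :: "nat \<Rightarrow> nat \<Rightarrow> bool" where
  "flips i k \<longleftrightarrow> yields X (ps k) ((ss k)(InReg i := True)) True"

definition K :: "nat \<Rightarrow> nat" where "K i = Max {k. k \<le> T \<and> flips i k}"

definition r :: "nat \<Rightarrow> nat" where "r i = ps (K i)"

lemma not_flips_T: "\<not> flips i T"
proof
  assume "flips i T"
  then have "yields X (ps T) ((ss T)(InReg i := True)) True" by (simp add: flips_def)
  moreover have "exec X (ps T) ((ss T)(InReg i := True)) ((ss T)(InReg i := True))"
    using psT TermT by (subst exec_unfold) simp
  ultimately show False using yields_unique outT by fastforce
qed

text \<open>The maximum exists because index 0 flips by correctness on the unit vector; it lies
  below \<open>T\<close> because at the final \<open>!\<close> the output is already fixed to
  0.\<close>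

lemma K:
  assumes "i \<in> {1..n}"
  shows "K i < T" "flips i (K i)" "\<And>k. K i < k \<Longrightarrow> k \<le> T \<Longrightarrow> \<not> flips i k"
proof -
  have fl0: "flips i 0"
    using unit[OF assms] assms by (simp add: flips_def ps0 ss0 test_store_upd)
  have fin: "finite {k. k \<le> T \<and> flips i k}" by simp
  have "K i \<in> {k. k \<le> T \<and> flips i k}"
    unfolding K_def by (rule Max_in) (use fl0 in auto)
  then show "flips i (K i)" and "K i < T"
    using not_flips_T[of i] by (simp, metis (mono_tags) mem_Collect_eq le_neq_implies_less)
  show "\<not> flips i k" if "K i < k" "k \<le> T" for k
  proof
    assume "flips i k"
    then have "k \<le> K i" unfolding K_def using that by (intro Max_ge[OF fin]) simp
    then show False using that by simp
  qed
qed

text \<open>Any other instruction acts alike on the flipped store and would carry the flip to index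
  \<open>K i + 1\<close>, against maximality.\<close>

lemma read_at_r:
  assumes "i \<in> {1..n}"
  shows "X ! r i = PosTest (InGet i) \<or> X ! r i = NegTest (InGet i)"
proof (rule ccontr)
  assume *: "\<not> ?thesis"
  have "next_state (X ! r i) (ps (K i), (ss (K i))(InReg i := True))
      = (ps (Suc (K i)), (ss (Suc (K i)))(InReg i := True))"
    using next_state_upd_InReg[OF _ _ next_state_trace[OF K(1)[OF assms]]] * by (auto simp: r_def)
  then have "flips i (Suc (K i))"
    using K(2)[OF assms] yields_step[OF noTerm[OF K(1)[OF assms]]] unfolding flips_def r_def by simp
  then show False using K(1)[OF assms] K(3)[OF assms, of "Suc (K i)"] by simp
qed

lemma r_inj: "inj_on r {1..n}"
proof (rule inj_on_inverseI)
  fix i assume "i \<in> {1..n}"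
  from read_at_r[OF this]
  show "(case X ! r i of PosTest (InGet i) \<Rightarrow> i | NegTest (InGet i) \<Rightarrow> i) = i" by (elim disjE) simp_all
qed

lemma r_vis: "i \<in> {1..n} \<Longrightarrow> r i \<in> vis"
  using K(1)[of i] by (simp add: r_def vis_def)

lemma pos_case:
  assumes i: "i \<in> {1..n}" and X: "X ! r i = PosTest (InGet i)"
  shows "ps (Suc (K i)) = r i + 2" "ss (Suc (K i)) = ss (K i)" "r i + 1 \<notin> vis"
    "yields X (r i + 1) ((ss (K i))(InReg i := True)) True"
proof -
  have k: "K i < T" using K(1)[OF i] .
  show 1: "ps (Suc (K i)) = r i + 2" and "ss (Suc (K i)) = ss (K i)"
    using next_state_trace[OF k] X ss_InReg[of "K i" i] k by (auto simp: r_def)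
  show "r i + 1 \<notin> vis"
    using ps_gap[OF k] 1 unfolding vis_def by (force simp: r_def)
  show "yields X (r i + 1) ((ss (K i))(InReg i := True)) True"
    using K(2)[OF i] X unfolding flips_def r_def[symmetric] by (subst (asm) yields_step) auto
qed

text \<open>The last claim drives the count: if the zero run reached \<open>r i + 2\<close> with an
  unchanged store, it would meet the flipped run there, so that a later index flips.\<close>

lemma neg_case:
  assumes i: "i \<in> {1..n}" and X: "X ! r i = NegTest (InGet i)"
  shows "ps (Suc (K i)) = r i + 1" "ss (Suc (K i)) = ss (K i)"
    "yields X (r i + 2) ((ss (K i))(InReg i := True)) True"
    "\<lbrakk>Suc (K i) < T; ps (Suc (Suc (K i))) = r i + 2\<rbrakk> \<Longrightarrow> ss (Suc (Suc (K i))) \<noteq> ss (K i)"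
proof -
  have k: "K i < T" using K(1)[OF i] .
  show "ps (Suc (K i)) = r i + 1" and "ss (Suc (K i)) = ss (K i)"
    using next_state_trace[OF k] X ss_InReg[of "K i" i] k by (auto simp: r_def)
  show y: "yields X (r i + 2) ((ss (K i))(InReg i := True)) True"
    using K(2)[OF i] X unfolding flips_def r_def[symmetric] by (subst (asm) yields_step) auto
  show "ss (Suc (Suc (K i))) \<noteq> ss (K i)" if "Suc (K i) < T" "ps (Suc (Suc (K i))) = r i + 2"
  proof
    assume "ss (Suc (Suc (K i))) = ss (K i)"
    then have "flips i (Suc (Suc (K i)))" using y that by (simp add: flips_def)
    then show False using K(3)[OF i, of "Suc (Suc (K i))"] that by auto
  qed
qed

section \<open>Counting owned instructions against the length \<open>L n\<close>\<close>

abbreviation "R \<equiv> r ` {1..n}"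
abbreviation "\<tau> \<equiv> ps T"

text \<open>Each element of \<open>M\<close> owns the instruction right after it, and the elements of \<open>N\<close> inject into
  \<open>M\<close> by \<open>Suc\<close>. So there are at least \<open>n/2\<close> owned instructions besides the \<open>n\<close> decisive tests and
  the final \<open>!\<close>, which leaves no slack in length \<open>L n\<close>.\<close>

definition N :: "nat set" where "N = {r i | i. i \<in> {1..n} \<and> X ! r i = NegTest (InGet i) \<and> r i + 1 \<in> R}"
definition M :: "nat set" where "M = R - N"
definition E :: "nat set" where "E = Suc ` M"

lemma R_vis: "R \<subseteq> vis" using r_vis by blast

lemma vis_le: "p \<in> vis \<Longrightarrow> p \<le> \<tau>"
  using ps_mono by (auto simp: vis_def)

lemma tau_vis: "\<tau> \<in> vis" by (auto simp: vis_def)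

lemma tau_R: "\<tau> \<notin> R" using read_at_r TermT by force

lemma R_less: "p \<in> R \<Longrightarrow> p < \<tau>"
  using R_vis vis_le tau_R by (metis in_mono le_neq_implies_less)

text \<open>Two consecutive negative decisive tests are impossible: on the zero vector both fall
  through without effect, to the very position to which flipping the first input leads.\<close>

lemma Suc_N:
  assumes "p \<in> N" shows "Suc p \<in> M" "\<exists>j\<in>{1..n}. Suc p = r j \<and> X ! r j = PosTest (InGet j)"
proof -
  obtain i j where i: "i \<in> {1..n}" "p = r i" "X ! r i = NegTest (InGet i)"
    and j: "j \<in> {1..n}" "r i + 1 = r j"
    using assms by (auto simp: N_def)
  have pos: "X ! r j = PosTest (InGet j)"
  proof (rule ccontr)
    assume "X ! r j \<noteq> PosTest (InGet j)"
    then have neg: "X ! r j = NegTest (InGet j)" using read_at_r[OF j(1)] by blast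
    have "ps (K j) = ps (Suc (K i))"
      using neg_case(1)[OF i(1,3)] j(2) unfolding r_def by linarith
    from ps_inj[OF _ _ this] have k: "K j = Suc (K i)"
      using K(1)[OF i(1)] K(1)[OF j(1)] by linarith
    have "Suc (K i) < T" using K(1)[OF j(1)] k by simp
    moreover have "ps (Suc (Suc (K i))) = r i + 2"
      using neg_case(1)[OF j(1) neg] j(2) unfolding k by linarith
    moreover have "ss (Suc (Suc (K i))) = ss (K i)"
      using neg_case(2)[OF j(1) neg] neg_case(2)[OF i(1,3)] unfolding k by (rule trans)
    ultimately show False using neg_case(4)[OF i(1,3)] by blast
  qed
  have pj: "Suc p = r j" using i(2) j(2) by simp
  then show "\<exists>j\<in>{1..n}. Suc p = r j \<and> X ! r j = PosTest (InGet j)" using pos j(1) by blast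
  have "Suc p \<notin> N" using pos unfolding pj N_def by force
  then show "Suc p \<in> M" using pj j(1) by (simp add: M_def)
qed

lemma R_pos_M: "i \<in> {1..n} \<Longrightarrow> X ! r i = PosTest (InGet i) \<Longrightarrow> r i \<in> M"
  unfolding M_def N_def by force

lemma M_neg: "i \<in> {1..n} \<Longrightarrow> X ! r i = NegTest (InGet i) \<Longrightarrow> r i \<in> M \<Longrightarrow> r i + 1 \<notin> R"
  by (auto simp: M_def N_def)

text \<open>The instruction owned by a positive test is passed over by the zero run, which visits
  all of \<open>R\<close>; the one owned by a negative test in \<open>M\<close> is outside
  \<open>R\<close> by the definition of \<open>N\<close>.\<close>

lemma E_R: "R \<inter> E = {}"
proof -
  have "Suc (r i) \<notin> R" if "i \<in> {1..n}" "r i \<in> M" for i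
    using read_at_r[OF that(1)]
  proof
    assume "X ! r i = PosTest (InGet i)"
    then show ?thesis using pos_case(3)[OF that(1)] R_vis by auto
  next
    assume "X ! r i = NegTest (InGet i)"
    then show ?thesis using M_neg[OF that(1) _ that(2)] by simp
  qed
  note no = this
  show ?thesis
  proof (rule equals0I)
    fix x assume x: "x \<in> R \<inter> E"
    then obtain i where "i \<in> {1..n}" "r i \<in> M" "x = Suc (r i)" by (auto simp: E_def M_def)
    then show False using no[of i] x by (metis IntD1)
  qed
qed

text \<open>Some terminating run continues at the owned position: the flipped one for a positive
  test, the zero run for a negative one.\<close>

lemma E_less: "E \<subseteq> {..<length X}"
proof -
  have "Suc (r i) < length X" if "i \<in> {1..n}" "r i \<in> M" for i
    using read_at_r[OF that(1)]
  proof
    assume "X ! r i = PosTest (InGet i)"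
    then show ?thesis using yields_length[OF pos_case(4)[OF that(1)]] by simp
  next
    assume "X ! r i = NegTest (InGet i)"
    then show ?thesis
      using neg_case(1)[OF that(1)] ps_mono[of "Suc (K i)" T] K(1)[OF that(1)] psT by simp
  qed
  then show ?thesis by (auto simp: E_def M_def)
qed

lemma R_less_length: "R \<subseteq> {..<length X}"
  using R_less psT by fastforce

lemma cards:
  "card R = n" "card E = card M" "card N \<le> card M" "card M + card N = n"
  "finite R" "finite E" "finite M" "finite N" "Suc ` N \<subseteq> M"
proof -
  show R: "card R = n" using card_image[OF r_inj] by simp
  show fR: "finite R" by simp
  have NR: "N \<subseteq> R" by (auto simp: N_def)
  show fN: "finite N" using NR fR finite_subset by blast
  show fM: "finite M" by (simp add: M_def)
  show "finite E" using fM by (simp add: E_def)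
  show "card E = card M" by (simp add: E_def card_image)
  show sub: "Suc ` N \<subseteq> M" using Suc_N by auto
  show "card N \<le> card M" using card_mono[OF fM sub] by (simp add: card_image)
  show "card M + card N = n"
    using card_Diff_subset[OF fN NR] card_mono[OF fR NR] R by (simp add: M_def)
qed

text \<open>\<open>R\<close> and \<open>E\<close> together have at least
  \<open>n + (n + 1) div 2\<close> elements, so a single further position exhausts the length.
  \<open>x\<close> is kept general because it is taken as \<open>\<tau> + 1\<close> while
  \<open>\<tau> \<notin> E\<close> is still being proved.\<close>

lemma full:
  assumes "x \<notin> R" "x \<notin> E" "x < length X"
  shows "{..<length X} = R \<union> E \<union> {x}" "card (M - Suc ` N) \<le> 1"
proof -
  have "card (R \<union> E) = n + card M"
    using card_Un_disjoint[OF cards(5,6) E_R] cards by simp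
  then have c: "card (R \<union> E \<union> {x}) = n + card M + 1" using assms cards by simp
  have sub: "R \<union> E \<union> {x} \<subseteq> {..<length X}" using assms R_less_length E_less by auto
  have le: "n + card M + 1 \<le> L n" using card_mono[OF _ sub] c len by simp
  then have M: "card M = (n + 1) div 2" using cards(3,4) unfolding L_eq by linarith
  show "{..<length X} = R \<union> E \<union> {x}"
    by (rule card_subset_eq[symmetric]) (use sub c M len in \<open>auto simp: L_eq\<close>)
  \<comment> \<open>Since \<open>card M = (n + 1) div 2\<close> and \<open>card N = n div 2\<close>,
    the difference is the parity of \<open>n\<close>.\<close>
  have "card (M - Suc ` N) = card M - card N"
    using card_Diff_subset[of "Suc ` N" M] cards by (simp add: card_image)
  then show "card (M - Suc ` N) \<le> 1" using M cards(3,4) by linarith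
qed

text \<open>Otherwise a negative test owns \<open>\<tau>\<close>, and the flipped run goes to
  \<open>\<tau> + 1\<close>. The count makes this the last position, hence a \<open>!\<close>, so
  the output would be 1 already at the test. But the zero run ends one step after that test with the
  same store and output 0.\<close>

lemma tau_E: "\<tau> \<notin> E"
proof
  assume "\<tau> \<in> E"
  then obtain i where i: "i \<in> {1..n}" "r i \<in> M" "\<tau> = r i + 1" by (auto simp: E_def M_def)
  then have neg: "X ! r i = NegTest (InGet i)"
    using read_at_r pos_case(3) tau_vis by metis
  let ?s = "(ss (K i))(InReg i := True)"
  have y: "yields X (\<tau> + 1) ?s True" using neg_case(3)[OF i(1) neg] i by simp
  have lt: "\<tau> + 1 < length X" using yields_length[OF y] .
  have "\<tau> + 1 \<notin> R" using R_less by fastforce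
  moreover have "\<tau> + 1 \<notin> E" using tau_R by (auto simp: E_def M_def)
  ultimately have cov: "{..<length X} = R \<union> E \<union> {\<tau> + 1}" using full(1) lt by blast
  have "\<tau> + 2 \<notin> R \<union> E \<union> {\<tau> + 1}" using R_less by (fastforce simp: E_def M_def)
  then have "\<tau> + 2 \<notin> {..<length X}" unfolding cov .
  then have last: "length X = \<tau> + 2" using lt by auto
  obtain s' where s': "exec X (\<tau> + 1) ?s s'" "s' OutReg" using y by (auto simp: yields_def)
  have "X ! (\<tau> + 1) = Term"
  proof (rule ccontr)
    assume nt: "X ! (\<tau> + 1) \<noteq> Term"
    then have "fst (next_state (X ! (\<tau> + 1)) (\<tau> + 1, ?s)) < length X"
      using s'(1) exec_length by (subst (asm) exec_unfold) auto
    then show False using next_state_progress[OF s'(1) nt] last by simp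
  qed
  then have "s' = ?s" using s'(1) by (subst (asm) exec_unfold) simp
  then have "ss (K i) OutReg" using s' by simp
  moreover have "Suc (K i) = T"
    by (rule ps_inj) (use neg_case(1)[OF i(1) neg] i(3) K(1)[OF i(1)] in linarith)+
  ultimately show False using neg_case(2)[OF i(1) neg] outT by simp
qed

lemma cover: "{..<length X} = R \<union> E \<union> {\<tau>}"
  using full(1) tau_E tau_R psT by blast

lemma position_cases: "p < length X \<Longrightarrow> p \<in> R \<or> p \<in> E \<or> p = \<tau>"
  using cover by (metis Un_iff lessThan_iff singletonD)

lemma single: "p \<in> M - Suc ` N \<Longrightarrow> q \<in> M - Suc ` N \<Longrightarrow> p = q"
  using full(2)[OF tau_R tau_E psT] cards by (auto simp: card_le_Suc0_iff_eq)

text \<open>On such a stretch the zero run does nothing but read decisive inputs, so a store in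
  which these are 0 takes the same path.\<close>

lemma reads_only:
  assumes "\<And>l. l0 \<le> l \<Longrightarrow> l < T \<Longrightarrow> ps l \<in> R" "l0 \<le> T"
    and "\<And>j. j \<in> {1..n} \<Longrightarrow> ps l0 \<le> r j \<Longrightarrow> \<not> s (InReg j)"
  shows "exec X (ps l0) s s"
  using assms(2,1,3)
proof (induction l0 rule: inc_induct)
  case base
  then show ?case using psT TermT by (subst exec_unfold) simp
next
  case (step l)
  obtain j where j: "j \<in> {1..n}" "ps l = r j" using step.prems(1)[of l] step.hyps by auto
  have "\<not> s (InReg j)" using step.prems(2)[OF j(1)] j(2) by simp
  moreover have "\<not> ss l (InReg j)" using ss_InReg step by auto
  ultimately have "next_state (X ! ps l) (ps l, s) = (ps (Suc l), s)"
    using next_state_trace[of l] read_at_r[OF j(1)] j step by auto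
  moreover have "exec X (ps (Suc l)) s s"
    by (rule step.IH) (use step ps_less[of l] in auto)
  moreover have "ps l < length X" using ps_mono[of l T] psT step by auto
  ultimately show ?case using noTerm[of l] step by (subst exec_unfold) auto
qed

text \<open>A negative test in \<open>M\<close> would be the one element of \<open>M\<close> that is
  not paired with an element of \<open>N\<close>. Then the instruction it owns is the only
  non-decisive one that the zero run executes before \<open>!\<close>. The flipped run bypasses it,
  meets tests only, and could not produce output 1.\<close>

lemma M_pos:
  assumes i: "i \<in> {1..n}" "r i \<in> M"
  shows "X ! r i = PosTest (InGet i)"
proof (rule ccontr)
  assume "\<not> ?thesis"
  then have neg: "X ! r i = NegTest (InGet i)" using read_at_r[OF i(1)] by blast
  let ?k = "K i" and ?p = "r i + 1"
  have k: "?k < T" using K(1)[OF i(1)] .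
  have p: "ps (Suc ?k) = ?p" using neg_case(1)[OF i(1) neg] .
  have pR: "?p \<notin> R" using M_neg[OF i(1) neg i(2)] .
  have "?p \<in> E" using i by (auto simp: E_def)
  then have pT: "?p \<noteq> \<tau>" using tau_E by auto
  then have k1: "Suc ?k < T" using p k by (cases "Suc ?k = T") auto
  have "r i \<notin> Suc ` N"
  proof
    assume "r i \<in> Suc ` N"
    then obtain j where "r i = r j" "X ! r j = PosTest (InGet j)" using Suc_N(2) by (metis imageE)
    then show False using neg by simp
  qed
  then have iS: "r i \<in> M - Suc ` N" using i(2) by blast
  have visR: "ps l \<in> R" if "l < T" "ps l \<noteq> ?p" for l
  proof (rule ccontr)
    assume "ps l \<notin> R"
    moreover have "ps l < length X" "ps l \<noteq> \<tau>" using ps_strict[of l T] that psT by auto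
    ultimately have "ps l \<in> E" using position_cases by blast
    then obtain j where j: "j \<in> {1..n}" "r j \<in> M" "ps l = Suc (r j)" by (auto simp: E_def M_def)
    then have "r j \<in> Suc ` N" using single[OF iS, of "r j"] that by auto
    then obtain j' where "r j = r j'" "X ! r j' = PosTest (InGet j')"
      using Suc_N(2) by (metis imageE)
    then have "X ! r j = PosTest (InGet j)" using read_at_r[OF j(1)] by auto
    then have "ps l \<notin> vis" using pos_case(3)[OF j(1)] j(3) by simp
    then show False using that by (auto simp: vis_def)
  qed
  \<comment> \<open>\<open>?p + 1\<close> is decisive or \<open>\<tau>\<close>, hence visited, and
    positions increase; so the owned instruction leads to exactly the place where the flipped run
    resumes.\<close>
  have ps2: "ps (Suc (Suc ?k)) = ?p + 1"
  proof -
    have "?p + 1 < length X"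
      using ps_strict[of "Suc ?k" T] k1 p psT by auto
    moreover have "?p + 1 \<notin> E" using pR by (auto simp: E_def M_def)
    ultimately have "?p + 1 \<in> vis" using position_cases[of "?p + 1"] R_vis tau_vis by auto
    then obtain l where l: "l \<le> T" "?p + 1 = ps l" by (auto simp: vis_def)
    show ?thesis using ps_gap[OF k1 l(1)] l(2) p ps_less[OF k1] by linarith
  qed
  let ?s = "(ss ?k)(InReg i := True)"
  have "exec X (ps (Suc (Suc ?k))) ?s ?s"
  proof (rule reads_only)
    fix l assume "Suc (Suc ?k) \<le> l" "l < T"
    then show "ps l \<in> R" using visR[of l] ps_mono[of "Suc (Suc ?k)" l] ps2 by linarith
  next
    fix j assume "j \<in> {1..n}" "ps (Suc (Suc ?k)) \<le> r j"
    then have "r i < r j" using ps2 by linarith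
    then show "\<not> ?s (InReg j)" using ss_InReg[of ?k] k by auto
  qed (use k1 in auto)
  then have "ss ?k OutReg"
    using yields_unique[OF neg_case(3)[OF i(1) neg], of ?s] unfolding ps2 by simp
  moreover have "ss l = test_store 0 0" if "l \<le> ?k" for l
    using that
  proof (induction l)
    case 0 then show ?case by (simp add: ss0)
  next
    case (Suc l)
    have "ps l < ps ?k" using ps_strict[of l ?k] Suc k by auto
    then have "ps l \<noteq> ?p" "l < T" using Suc k by (simp_all add: r_def)
    then obtain j where j: "j \<in> {1..n}" "ps l = r j" using visR[of l] by blast
    then show ?case using next_state_trace[OF \<open>l < T\<close>] read_at_r[OF j(1)] Suc by (auto split: if_splits)
  qed
  ultimately show False by simp
qed

lemma E_vis: "E \<inter> vis = {}"
proof (rule equals0I)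
  fix x assume x: "x \<in> E \<inter> vis"
  then obtain i where i: "i \<in> {1..n}" "r i \<in> M" "x = r i + 1" by (auto simp: E_def M_def)
  then show False using pos_case(3)[OF i(1) M_pos[OF i(1,2)]] x by simp
qed

lemma vis_eq: "vis = R \<union> {\<tau>}"
proof -
  have "vis \<subseteq> {..<length X}" using vis_le psT by fastforce
  then show ?thesis using position_cases E_vis R_vis tau_vis by (auto simp del: One_nat_def)
qed

lemma neg_N: "i \<in> {1..n} \<Longrightarrow> X ! r i = NegTest (InGet i) \<Longrightarrow> r i \<in> N"
  using M_pos[of i] by (auto simp: M_def)

lemma r_successors:
  assumes i: "i \<in> {1..n}"
  shows "X ! r i = PosTest (InGet i) \<and> r i + 1 \<in> E \<and> r i + 2 \<in> R \<union> {\<tau>} \<or>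
    X ! r i = NegTest (InGet i) \<and> r i + 1 \<in> R \<and> r i + 2 \<in> E"
  using read_at_r[OF i]
proof
  assume pos: "X ! r i = PosTest (InGet i)"
  have "r i + 2 \<in> vis"
    using pos_case(1)[OF i pos] K(1)[OF i]
    by (auto simp: vis_def image_iff intro!: bexI[of _ "Suc (K i)"])
  then show ?thesis using pos R_pos_M[OF i pos] vis_eq by (auto simp: E_def)
next
  assume neg: "X ! r i = NegTest (InGet i)"
  have "Suc (r i) \<in> M" using Suc_N neg_N[OF i neg] by auto
  then show ?thesis using neg by (auto simp: E_def M_def)
qed

lemma blocks: "block_structure X n r E \<tau>"
proof
  show "length X = Suc \<tau>"
  proof (rule ccontr)
    assume "\<not> ?thesis"
    then have "Suc \<tau> < length X" using psT by linarith
    then have "Suc \<tau> \<in> R \<or> Suc \<tau> \<in> E" using position_cases[of "Suc \<tau>"] by simp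
    then obtain p where "p \<in> R" "Suc \<tau> = p \<or> \<tau> = p" by (auto simp: E_def M_def)
    then show False using R_less by fastforce
  qed
  show "q \<in> E \<Longrightarrow> \<exists>i\<in>{1..n}. q = r i + 1 \<and> X ! r i = PosTest (InGet i)" for q
    using M_pos by (auto simp: E_def M_def)
  have ER: "q \<notin> R" if "q \<in> E" for q using E_R that by auto
  have NR: "N \<subseteq> R" by (auto simp: N_def)
  show "q = q'" if "q \<in> E" "q + 2 \<in> E" "q' \<in> E" "q' + 2 \<in> E" for q q'
  proof -
    \<comment> \<open>\<open>q + 2 \<in> E\<close> makes \<open>q + 1\<close> a decisive test in
      \<open>M\<close>, and \<open>q\<close>, being no decisive test, cannot be its partner in
      \<open>N\<close>. The count leaves at most one such unpaired test.\<close>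
    have "q + 1 \<in> M" "q' + 1 \<in> M" using that by (auto simp: E_def)
    moreover have "q \<notin> N" "q' \<notin> N" using ER[OF that(1)] ER[OF that(3)] NR by (meson subsetD)+
    then have "q + 1 \<notin> Suc ` N" "q' + 1 \<notin> Suc ` N" by auto
    ultimately show ?thesis using single[of "q + 1" "q' + 1"] by auto
  qed
  show "q + 1 \<in> R \<union> {\<tau>}" if "q \<in> E" for q
  proof -
    have "q \<noteq> \<tau>" "q < length X" using that tau_E E_less by auto
    moreover have "length X = Suc \<tau>" by fact
    ultimately have "q + 1 < length X" by auto
    moreover have "q + 1 \<notin> E" using ER[OF that] by (auto simp: E_def M_def)
    ultimately show ?thesis using position_cases[of "q + 1"] by blast
  qed
  have "0 \<in> vis" using ps0 by (force simp: vis_def)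
  then show "0 \<in> R \<union> {\<tau>}" using vis_eq by simp
  show "X ! r i = PosTest (InGet i) \<and> r i + 1 \<in> E \<and> r i + 2 \<in> R \<union> {\<tau>} \<or>
        X ! r i = NegTest (InGet i) \<and> r i + 1 \<in> R \<and> r i + 2 \<in> E" if "i \<in> {1..n}" for i
    using r_successors[OF that] .
qed (use cover E_R tau_E tau_R TermT r_inj in auto)

end

subsection \<open>The test vectors\<close>

text \<open>The critical case is \<open>+in:c\<close> (form 6) directly before a one-input block \<open>+in:a\<close> (form 6). In a
  sequence with the block structure, 12 arises as the sum of adjacent forms after that place in no
  other way.\<close>

fun scan :: "int \<Rightarrow> int \<Rightarrow> int \<Rightarrow> prim list \<Rightarrow> int" where
  "scan c f a [] = c"
| "scan c f a (u # us) =
     scan (if f + prim_form u = 12 then a else c) (prim_form u) (prim_param u) us"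

text \<open>The initial values are the contents of fresh cells. A first instruction of form 12 also
  gives the sum 12 with them, but only stores 0 again.\<close>

definition special_input :: "prim list \<Rightarrow> int" where
  "special_input X = scan 0 0 0 X"

lemma ex_less_shift: "(\<exists>p<n. P (Suc p)) \<longleftrightarrow> (\<exists>i\<in>{1..n}. P i)"
  unfolding image_Suc_lessThan[symmetric] by auto

lemma tstnz_iff_nth: "tstnz bs \<longleftrightarrow> (\<exists>p<length bs. bs ! p)"
proof
  assume "\<exists>p<length bs. bs ! p"
  then obtain p where "p < length bs" "bs ! p" by blast
  then show "tstnz bs" using nth_mem[of p bs] unfolding tstnz_def by blast
qed (unfold tstnz_def, metis in_set_conv_nth)

lemma scan_unchanged:
  assumes "\<And>p. p < length us \<Longrightarrow>
      (case p of 0 \<Rightarrow> f | Suc p' \<Rightarrow> prim_form (us ! p')) + prim_form (us ! p) \<noteq> 12"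
  shows "scan c f a us = c"
  using assms
proof (induction us arbitrary: f a)
  case (Cons u us)
  have "scan c (prim_form u) (prim_param u) us = c"
  proof (rule Cons.IH)
    fix p assume "p < length us"
    then show "(case p of 0 \<Rightarrow> prim_form u | Suc p' \<Rightarrow> prim_form (us ! p')) + prim_form (us ! p) \<noteq> 12"
      using Cons.prems[of "Suc p"] by (cases p) auto
  qed
  moreover have "f + prim_form u \<noteq> 12" using Cons.prems[of 0] by simp
  ultimately show ?case by simp
qed simp

lemma scan_last_pair:
  assumes "q + 1 < length us" "prim_form (us ! q) + prim_form (us ! (q + 1)) = 12"
    and "\<And>p. q < p \<Longrightarrow> p + 1 < length us \<Longrightarrow> prim_form (us ! p) + prim_form (us ! (p + 1)) \<noteq> 12"
  shows "scan c f a us = prim_param (us ! q)"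
  using assms
proof (induction us arbitrary: q c f a)
  case (Cons u us)
  show ?case
  proof (cases q)
    case (Suc q')
    show ?thesis unfolding scan.simps Suc nth_Cons_Suc
      by (rule Cons.IH) (use Cons.prems(1,2) Cons.prems(3)[of "Suc p" for p] Suc in auto)
  next
    case 0
    then obtain v vs where us: "us = v # vs" using Cons.prems by (cases us) auto
    have "scan (prim_param u) (prim_form v) (prim_param v) vs = prim_param u"
    proof (rule scan_unchanged)
      fix p assume "p < length vs"
      then show "(case p of 0 \<Rightarrow> prim_form v | Suc p' \<Rightarrow> prim_form (vs ! p')) + prim_form (vs ! p) \<noteq> 12"
        using Cons.prems(3)[of "Suc p"] 0 us by (cases p) auto
    qed
    then show ?thesis using Cons.prems(2) 0 us by simp
  qed
qed simp

text \<open>The values 0 and -1 of \<open>special_input X\<close> mean that there is no second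
  index. A value above \<open>n\<close> is tested as well: \<open>computes\<close> leaves these
  registers arbitrary, so a correct sequence has to cope with them.\<close>

definition passes :: "prim list \<Rightarrow> nat \<Rightarrow> bool" where
  "passes X n \<longleftrightarrow> yields X 0 (test_store 0 0) False \<and>
     (\<forall>i \<in> {1..n}. yields X 0 (test_store i 0) True \<and>
        (0 < special_input X \<longrightarrow> yields X 0 (test_store i (nat (special_input X))) True))"

subsection \<open>Correctness of sequences that pass the tests\<close>

context block_structure
begin

abbreviation "R \<equiv> r ` {1..n}"

lemma position_cases: "p < length X \<Longrightarrow> p \<in> R \<or> p \<in> E \<or> p = \<tau>"
  using cover by (metis Un_iff lessThan_iff singletonD)

lemma R_not_E: "p \<in> R \<Longrightarrow> p \<notin> E"
  using disjoint(1) by blast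

lemma R_length: "p \<in> R \<union> {\<tau>} \<Longrightarrow> p < length X"
  using cover by (metis Un_iff lessThan_iff)

lemma E_length: "p \<in> E \<Longrightarrow> p < length X"
  using cover by (metis Un_iff lessThan_iff)

text \<open>The target of the branch that the decisive test takes on reply 1.\<close>

definition entry :: "nat \<Rightarrow> nat" where
  "entry i = (if X ! r i = PosTest (InGet i) then r i + 1 else r i + 2)"

lemma entry: "i \<in> {1..n} \<Longrightarrow> entry i \<in> E \<and> r i < entry i"
  using reads[of i] by (auto simp: entry_def)

lemma miss:
  assumes "p \<in> R \<union> {\<tau>}" "\<And>j. j \<in> {1..n} \<Longrightarrow> p \<le> r j \<Longrightarrow> \<not> s (InReg j)"
  shows "exec X p s s"
  using assms
proof (induction "length X - p" arbitrary: p rule: less_induct)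
  case less
  show ?case
  proof (cases "p = \<tau>")
    case True
    then show ?thesis using R_length[OF less.prems(1)] Term by (subst exec_unfold) simp
  next
    case False
    then obtain j where j: "j \<in> {1..n}" "p = r j" using less.prems(1) by blast
    have s: "\<not> s (InReg j)" using less.prems(2) j by simp
    have pl: "p < length X" using R_length less.prems(1) by blast
    from reads[OF j(1)] show ?thesis
    proof (elim disjE conjE)
      assume X: "X ! r j = PosTest (InGet j)" and "r j + 2 \<in> R \<union> {\<tau>}"
      then have "exec X (p + 2) s s" using pl j by (intro less.hyps less.prems(2)) auto
      then show ?thesis using pl X s j by (subst exec_unfold) simp
    next
      assume X: "X ! r j = NegTest (InGet j)" and "r j + 1 \<in> R"
      then have "exec X (p + 1) s s" using pl j by (intro less.hyps less.prems(2)) auto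
      then show ?thesis using pl X s j by (subst exec_unfold) simp
    qed
  qed
qed

lemma hit:
  assumes i: "i \<in> {1..n}" "s (InReg i)"
    and "p \<in> R \<union> {\<tau>}" "p \<le> r i"
    and "\<And>j. j \<in> {1..n} \<Longrightarrow> p \<le> r j \<Longrightarrow> r j < r i \<Longrightarrow> \<not> s (InReg j)"
  shows "exec X p s s' \<longleftrightarrow> exec X (entry i) s s'"
  using assms(3-)
proof (induction "length X - p" arbitrary: p rule: less_induct)
  case less
  have pl: "p < length X" using R_length less.prems(1) by blast
  have ri: "r i \<in> R" "r i \<noteq> \<tau>" using i(1) disjoint(3) by auto
  have "p \<noteq> \<tau>"
  proof
    assume "p = \<tau>"
    then have "\<tau> < r i" using less.prems(2) ri(2) by simp
    then show False using R_length[of "r i"] ri(1) len by auto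
  qed
  then obtain j where j: "j \<in> {1..n}" "p = r j" using less.prems(1) by blast
  show ?case
  proof (cases "j = i")
    case True
    from reads[OF i(1)] show ?thesis
    proof (elim disjE conjE)
      assume X: "X ! r i = PosTest (InGet i)"
      show ?thesis using pl X i(2) j(2) unfolding True by (subst exec_unfold) (simp add: entry_def)
    next
      assume X: "X ! r i = NegTest (InGet i)"
      show ?thesis using pl X i(2) j(2) unfolding True by (subst exec_unfold) (simp add: entry_def)
    qed
  next
    case False
    then have lt: "p < r i"
      using less.prems(2) inj i(1) j by (metis inj_onD le_neq_implies_less)
    have s: "\<not> s (InReg j)" using less.prems(3)[OF j(1)] lt j(2) by simp
    from reads[OF j(1)] show ?thesis
    proof (elim disjE conjE)
      assume X: "X ! r j = PosTest (InGet j)" and E: "r j + 1 \<in> E" and R: "r j + 2 \<in> R \<union> {\<tau>}"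
      \<comment> \<open>A failing positive test passes over \<open>r j + 1\<close>; the awaited test
        must not be lost there.\<close>
      have "r i \<noteq> r j + 1" using E ri(1) disjoint(1) by auto
      then have "exec X (p + 2) s s' \<longleftrightarrow> exec X (entry i) s s'"
        using pl j(2) lt R by (intro less.hyps less.prems(3)) auto
      moreover have "exec X p s s' \<longleftrightarrow> exec X (p + 2) s s'"
        using pl X s j(2) by (subst exec_unfold) simp
      ultimately show ?thesis by simp
    next
      assume X: "X ! r j = NegTest (InGet j)" and R: "r j + 1 \<in> R"
      have "exec X (p + 1) s s' \<longleftrightarrow> exec X (entry i) s s'"
        using pl j(2) lt R by (intro less.hyps less.prems(3)) auto
      moreover have "exec X p s s' \<longleftrightarrow> exec X (p + 1) s s'"
        using pl X s j(2) by (subst exec_unfold) simp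
      ultimately show ?thesis by simp
    qed
  qed
qed

lemma yields_hit:
  assumes "i \<in> {1..n}" "s (InReg i)" "p \<in> R \<union> {\<tau>}" "p \<le> r i"
    and "\<And>j. j \<in> {1..n} \<Longrightarrow> p \<le> r j \<Longrightarrow> r j < r i \<Longrightarrow> \<not> s (InReg j)"
  shows "yields X p s b \<longleftrightarrow> yields X (entry i) s b"
  unfolding yields_def using hit[of i s p, OF assms] by blast

lemma first_hit:
  assumes "j \<in> {1..n}" "s (InReg j)" "p \<le> r j"
  obtains i where "i \<in> {1..n}" "s (InReg i)" "p \<le> r i"
    "\<And>k. k \<in> {1..n} \<Longrightarrow> p \<le> r k \<Longrightarrow> r k < r i \<Longrightarrow> \<not> s (InReg k)"
proof -
  obtain i where "i \<in> {1..n} \<and> s (InReg i) \<and> p \<le> r i"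
    and "\<And>k. k \<in> {1..n} \<and> s (InReg k) \<and> p \<le> r k \<Longrightarrow> r i \<le> r k"
    using ex_has_least_nat[of "\<lambda>i. i \<in> {1..n} \<and> s (InReg i) \<and> p \<le> r i" j r] assms by blast
  then show thesis using that[of i] assms by (meson leD)
qed

text \<open>Control has to stay inside \<open>X\<close>. The negative test skips an instruction on
  reply 1, hence its bound; in the other cases \<open>E_succ\<close> provides the next
  position.\<close>

definition sets :: "nat \<Rightarrow> bool" where
  "sets q \<longleftrightarrow> X ! q = Plain (OutSet True) \<or> X ! q = PosTest (OutSet True) \<or>
     X ! q = NegTest (OutSet True) \<and> q + 2 < length X"

definition jumps :: "nat \<Rightarrow> bool" where
  "jumps q \<longleftrightarrow> (\<exists>l>0. X ! q = Jump l \<and> q + l \<in> E)"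

definition skips :: "nat \<Rightarrow> store \<Rightarrow> bool" where
  "skips q s \<longleftrightarrow> q + 2 \<in> E \<and>
     (\<exists>a. X ! q = PosTest a \<and> \<not> reply a s \<or> X ! q = NegTest a \<and> reply a s)"

text \<open>With a single nonzero input, all inputs read after position \<open>q\<close> are 0, so nothing but \<open>E\<close> can
  still produce output 1.\<close>

lemma E_instr:
  assumes q: "q \<in> E" and i: "i \<in> {1..n}" "r i < q" and y: "yields X q (test_store i 0) True"
  shows "sets q \<or> jumps q \<or> skips q (test_store i 0)"
proof -
  have quiet: "s OutReg" if "yields X p s True" "p \<in> R \<union> {\<tau>}" "q < p"
    "\<And>j. s (InReg j) = test_store i 0 (InReg j)" for p s
  proof -
    have "exec X p s s"
    proof (rule miss[OF that(2)])
      fix j assume "j \<in> {1..n}" "p \<le> r j"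
      then have "j \<noteq> i" using i that(3) by auto
      then show "\<not> s (InReg j)" unfolding that(4) by auto
    qed
    then show ?thesis using yields_unique[OF that(1)] by simp
  qed
  obtain s where s: "exec X q (test_store i 0) s" "s OutReg" using y by (auto simp: yields_def)
  have nt: "X ! q \<noteq> Term"
  proof
    assume "X ! q = Term"
    then have "s = test_store i 0" using s(1) by (subst (asm) exec_unfold) simp
    then show False using s(2) by simp
  qed
  obtain p' s' where n: "next_state (X ! q) (q, test_store i 0) = (p', s')" by (metis surj_pair)
  then have y': "yields X p' s' True" using yields_step[OF nt n] y by simp
  have lt: "q < p'" using next_state_progress[OF s(1) nt] n by simp
  have inp: "s' (InReg j) = test_store i 0 (InReg j)" for j using next_state_InReg[OF n] .
  have p'len: "p' < length X" using yields_length[OF y'] .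
  have out: "s' OutReg" if "p' \<notin> E"
    using quiet[OF y' _ lt inp] that position_cases[OF p'len] by blast
  have E1: "q + 1 \<notin> E" using E_succ[OF q] disjoint by auto
  show ?thesis
  proof (cases "X ! q")
    case (Plain a)
    then have "s' OutReg" using out n E1 by simp
    then show ?thesis using Plain n by (cases a) (auto simp: sets_def)
  next
    case (PosTest a)
    then have "\<not> reply a (test_store i 0) \<and> q + 2 \<in> E \<or> s' OutReg" using out n E1 by (auto split: if_splits)
    then show ?thesis using PosTest n by (cases a) (auto simp: sets_def skips_def)
  next
    case (NegTest a)
    then have "reply a (test_store i 0) \<and> q + 2 \<in> E \<or> s' OutReg" using out n E1 by (auto split: if_splits)
    then show ?thesis using NegTest n p'len by (cases a) (auto simp: sets_def skips_def)
  next
    case (Jump l)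
    then have "s' = test_store i 0" "p' = q + l" using n by auto
    then show ?thesis using out lt Jump by (auto simp: jumps_def)
  qed (use nt in simp)
qed

end

locale passing_blocks = block_structure +
  assumes valid: "u \<in> set X \<Longrightarrow> valid_prim u"
    and unit: "i \<in> {1..n} \<Longrightarrow> yields X 0 (test_store i 0) True"
    and unit': "i \<in> {1..n} \<Longrightarrow> 0 < special_input X \<Longrightarrow> yields X 0 (test_store i (nat (special_input X))) True"
begin

lemma unit_entry: "i \<in> {1..n} \<Longrightarrow> yields X (entry i) (test_store i 0) True"
  using yields_hit[of i "test_store i 0" 0 True] unit[of i] start by auto

lemma E_instr': "q \<in> E \<Longrightarrow> sets q \<or> jumps q \<or> (\<exists>i. skips q (test_store i 0))"
proof -
  assume q: "q \<in> E"
  then obtain i where i: "i \<in> {1..n}" "q = r i + 1" "X ! r i = PosTest (InGet i)"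
    using E_pred by blast
  then have "entry i = q" by (simp add: entry_def)
  then show ?thesis using E_instr[OF q i(1)] i(2) unit_entry[OF i(1)] by auto
qed

text \<open>Decisive tests write nothing, and an \<open>e\<close> sets the output to 1 or jumps to a
  later \<open>e\<close>, so output 1 persists and is reached from any \<open>e\<close> beyond the
  exceptional one.\<close>

lemma yields_True:
  assumes "p < length X" "s OutReg \<or> p \<in> E \<and> (\<forall>q\<ge>p. q \<in> E \<longrightarrow> q + 2 \<notin> E)"
  shows "yields X p s True"
  using assms
proof (induction "length X - p" arbitrary: p s rule: less_induct)
  case less
  obtain p' s' where n: "next_state (X ! p) (p, s) = (p', s')" by (metis surj_pair)
  have go: ?case if "X ! p \<noteq> Term" "p < p'" "p' < length X"
    "s' OutReg \<or> p' \<in> E \<and> (\<forall>q\<ge>p'. q \<in> E \<longrightarrow> q + 2 \<notin> E)"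
    using yields_step[OF that(1) n] less.hyps[of p' s'] that less.prems by auto
  consider "p \<in> R" | "p \<in> E" | "p = \<tau>" using position_cases[OF less.prems(1)] by blast
  then show ?case
  proof cases
    case 1
    then obtain j where j: "j \<in> {1..n}" "p = r j" by auto
    have "p \<notin> E" using 1 R_not_E by blast
    then have s: "s OutReg" using less.prems(2) by blast
    have "r j + 1 < length X" "r j + 2 < length X"
      using reads[OF j(1)] R_length[of "r j + 1"] R_length[of "r j + 2"] E_length by auto
    then show ?thesis using n reads[OF j(1)] s j(2) by (intro go) (auto split: if_splits)
  next
    case 2
    have p1: "p + 1 < length X" using R_length[OF E_succ[OF 2]] .
    from E_instr'[OF 2] show ?thesis
    proof (elim disjE exE)
      assume "sets p"
      then show ?thesis using n p1 by (intro go) (auto simp: sets_def)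
    next
      assume "jumps p"
      then show ?thesis using n less.prems(2) E_length by (intro go) (auto simp: jumps_def)
    next
      fix i assume sk: "skips p (test_store i 0)"
      then have p2: "p + 2 \<in> E" by (simp add: skips_def)
      have later: "\<forall>q\<ge>p + 2. q \<in> E \<longrightarrow> q + 2 \<notin> E" using skip_unique[OF 2 p2] by fastforce
      have s: "s OutReg" using less.prems(2) p2 2 by auto
      have same: "(\<exists>a. X ! p = PosTest a \<or> X ! p = NegTest a)" using sk by (auto simp: skips_def)
      \<comment> \<open>The exceptional test may write 0 to \<open>out\<close>, but then it skips to
        \<open>p + 2\<close>, which is in \<open>E\<close> with no exceptional place from there
        on.\<close>
      have "p' = p + 2 \<or> s' OutReg \<and> p' = p + 1"
        using sk n s unfolding skips_def
        by (elim conjE exE disjE) (rename_tac a, case_tac a, auto split: if_splits)+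
      then show ?thesis using p1 p2 later E_length same by (intro go) auto
    qed
  next
    case 3
    then have "s OutReg" using less.prems(2) disjoint by auto
    then show ?thesis using 3 Term less.prems(1) unfolding yields_def by (subst exec_unfold) auto
  qed
qed

lemma prim_form_cases:
  assumes "q \<in> E" "q + 2 \<notin> E"
  shows "prim_form (X ! q) \<in> {2, 8, 14, 18}"
  using E_instr'[OF assms(1)] assms(2) by (auto simp: sets_def jumps_def skips_def)

text \<open>Beyond \<open>q\<close>, decisive tests have form 6 or 12, every \<open>e\<close> has
  form 2, 8, 14 or 18, and \<open>!\<close> has 19. As form 6 is always followed by an
  \<open>e\<close>, no later adjacent pair sums to 12, and the pair at \<open>q\<close> is the last
  one.\<close>

lemma special_input_eq:
  assumes q: "q \<in> E" "q + 2 \<in> E" and X: "X ! q = PosTest (InGet c)"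
  shows "special_input X = int c"
proof -
  obtain j where j: "j \<in> {1..n}" "q + 1 = r j" "X ! r j = PosTest (InGet j)"
    using E_pred[OF q(2)] by auto
  have "scan 0 0 0 X = prim_param (X ! q)"
  proof (rule scan_last_pair)
    show "q + 1 < length X" using E_length[OF q(2)] by simp
    show "prim_form (X ! q) + prim_form (X ! (q + 1)) = 12" using X j by simp
    fix p assume p: "q < p" "p + 1 < length X"
    have E: "prim_form (X ! p) \<in> {2, 8, 14, 18}" if "p \<in> E" "q < p" for p
      using prim_form_cases[OF that(1)] skip_unique[OF q that(1)] that(2) by auto
    have R: "prim_form (X ! p) \<in> {6, 12}" if "p \<in> R" for p
    proof -
      obtain i where i: "i \<in> {1..n}" "p = r i" using \<open>p \<in> R\<close> by blast
      show ?thesis using reads[OF i(1)] unfolding i(2) by (elim disjE) simp_all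
    qed
    have "p \<noteq> \<tau>" using p len by auto
    then consider "p \<in> R" | "p \<in> E" using position_cases[of p] p by auto
    then show "prim_form (X ! p) + prim_form (X ! (p + 1)) \<noteq> 12"
    proof cases
      case 1
      then obtain i where i: "i \<in> {1..n}" "p = r i" by auto
      have "prim_form (X ! p) \<in> {6, 12}" using R 1 .
      moreover have "prim_form (X ! (p + 1)) \<in> {2, 8, 14, 18}" if "p + 1 \<in> E"
        using E that p by auto
      moreover have "prim_form (X ! p) = 12 \<and> prim_form (X ! (p + 1)) \<in> {6, 12}" if "p + 1 \<notin> E"
        using reads[OF i(1)] R[of "p + 1"] i(2) that by auto
      ultimately show ?thesis by (cases "p + 1 \<in> E") auto
    next
      case 2
      have "prim_form (X ! (p + 1)) \<in> {6, 12, 19}" using E_succ[OF 2] R Term by auto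
      then show ?thesis using E[OF 2 p(1)] by auto
    qed
  qed
  then show ?thesis using X by (simp add: special_input_def)
qed

text \<open>\<open>s\<close> and both test vectors follow the same jumps until the output is set or
  the exceptional place is met. There \<open>c\<close> is chosen so that
  \<open>test_store i c\<close> agrees with \<open>s\<close> on a test \<open>+in:c\<close>.\<close>

lemma yields_from_E:
  assumes q: "q \<in> E" and i: "i \<in> {1..n}" "r i < q" and s: "s (InReg i)"
    and aux: "\<And>p j. p < length X \<Longrightarrow> X ! p = PosTest (AuxGet j) \<or> X ! p = NegTest (AuxGet j) \<Longrightarrow>
      \<not> s (AuxReg j)"
    and c: "c = (if 0 < special_input X \<and> s (InReg (nat (special_input X))) then nat (special_input X) else 0)"
    and y: "yields X q (test_store i 0) True" and yc: "yields X q (test_store i c) True"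
  shows "yields X q s True"
  using q i(2) y yc
proof (induction "length X - q" arbitrary: q rule: less_induct)
  case less
  note q = less.prems(1)
  have ql: "q < length X" "q + 1 < length X" using E_length[OF q] R_length[OF E_succ[OF q]] .
  from E_instr[OF q i(1) less.prems(2,3)] show ?case
  proof (elim disjE)
    assume "sets q"
    then have "\<exists>p'>q. p' < length X \<and> X ! q \<noteq> Term \<and> next_state (X ! q) (q, s) = (p', s(OutReg := True))"
      using ql by (auto simp: sets_def)
    then show ?thesis using yields_step yields_True[of _ "s(OutReg := True)"] ql(1) by fastforce
  next
    assume "jumps q"
    then obtain l where l: "l > 0" "X ! q = Jump l" "q + l \<in> E" by (auto simp: jumps_def)
    have st: "yields X q s b \<longleftrightarrow> yields X (q + l) s b" for s b
      using yields_step[of X q s "q + l" s b] l ql by simp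
    show ?thesis unfolding st
      by (rule less.hyps) (use l ql less.prems in \<open>auto simp: st\<close>)
  next
    assume sk: "skips q (test_store i 0)"
    then have q2: "q + 2 \<in> E" by (simp add: skips_def)
    have later: "\<forall>p\<ge>p0. p \<in> E \<longrightarrow> p + 2 \<notin> E" if "q < p0" for p0
      using skip_unique[OF q q2] that by fastforce
    from sk obtain a where a: "X ! q = PosTest a \<and> \<not> reply a (test_store i 0) \<or>
        X ! q = NegTest a \<and> reply a (test_store i 0)" by (auto simp: skips_def)
    show ?thesis
    proof (cases "reply a s = reply a (test_store i 0)")
      case True
      then have "next_state (X ! q) (q, s) = (q + 2, effect a s)" "X ! q \<noteq> Term" using a by auto
      moreover have "yields X (q + 2) (effect a s) True"
        by (rule yields_True) (use q2 E_length[OF q2] later[of "q + 2"] in simp_all)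
      ultimately show ?thesis using yields_step[of X q s "q + 2"] ql by simp
    next
      case False
      \<comment> \<open>Set instructions have constant replies and tested auxiliary registers are 0
        in both stores, so the differing reply comes from an input.\<close>
      then obtain d where d: "a = InGet d"
        using a aux[OF ql(1)] by (cases a) auto
      have "valid_prim (X ! q)" using valid ql by simp
      then have d0: "d \<noteq> 0" using a d by auto
      have "d \<noteq> i" using False d s i by auto
      then have X: "X ! q = PosTest (InGet d)" and sd: "s (InReg d)" using a False d d0 by auto
      have cd: "c = d" using special_input_eq[OF q q2 X] c sd d0 by simp
      have st: "yields X q s b \<longleftrightarrow> yields X (q + 1) s b" if "s (InReg d)" for s b
        using yields_step[of X q s "q + 1" s b] X ql that by simp
      have y1: "yields X (q + 1) (test_store i c) True" using st[of "test_store i c"] less.prems(4) cd d0 by simp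
      \<comment> \<open>Without a decisive test of \<open>in:d\<close> from \<open>q + 1\<close> on,
        the vector with \<open>i\<close> and \<open>d\<close> would meet only zeros and end with
        output 0. This also rules out \<open>d\<close> beyond \<open>n\<close>.\<close>
      have "d \<in> {1..n} \<and> q + 1 \<le> r d"
      proof (rule ccontr)
        assume no: "\<not> ?thesis"
        have "exec X (q + 1) (test_store i c) (test_store i c)"
          by (rule miss[OF E_succ[OF q]]) (use no cd less.prems(2) in auto)
        from yields_unique[OF y1 this] show False by simp
      qed
      then obtain j where j: "j \<in> {1..n}" "s (InReg j)" "q + 1 \<le> r j"
        "\<And>k. k \<in> {1..n} \<Longrightarrow> q + 1 \<le> r k \<Longrightarrow> r k < r j \<Longrightarrow> \<not> s (InReg k)"
        using first_hit[of d s "q + 1"] sd by metis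
      have "yields X (entry j) s True"
        by (rule yields_True) (use entry[OF j(1)] E_length later[of "entry j"] j(3) in auto)
      then have "yields X (q + 1) s True"
        using yields_hit[of j s "q + 1", OF j(1,2) E_succ[OF q] j(3,4)] by simp
      then show ?thesis using st[of s, OF sd] by simp
    qed
  qed
qed

lemma computes_tstnz: "computes X n tstnz"
proof -
  \<comment> \<open>The default 0 lets the maximum range over all instructions; it bounds every
    auxiliary register whose content is tested.\<close>
  define g where "g u = (case u of PosTest (AuxGet j) \<Rightarrow> j | NegTest (AuxGet j) \<Rightarrow> j | _ \<Rightarrow> 0)" for u
  define k where "k = Max (g ` set X)"
  have k: "j \<le> k" if "p < length X" "X ! p = PosTest (AuxGet j) \<or> X ! p = NegTest (AuxGet j)" for p j
  proof -
    have "g (X ! p) \<le> k" unfolding k_def using that(1) by (intro Max_ge) simp_all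
    moreover have "g (X ! p) = j" using that(2) by (elim disjE) (simp_all add: g_def)
    ultimately show ?thesis by simp
  qed
  show ?thesis unfolding computes_def
  proof (intro exI[of _ k] allI impI)
    fix bs s
    assume A: "length bs = n \<and> (\<forall>i\<in>{1..n}. s (InReg i) = bs ! (i - 1)) \<and>
      s OutReg = False \<and> (\<forall>i\<in>{1..k}. s (AuxReg i) = False)"
    then have inp: "\<And>i. i \<in> {1..n} \<Longrightarrow> s (InReg i) = bs ! (i - 1)" and out: "\<not> s OutReg"
      and aux: "\<And>i. i \<in> {1..k} \<Longrightarrow> \<not> s (AuxReg i)" and lbs: "length bs = n" by simp_all
    have "tstnz bs \<longleftrightarrow> (\<exists>p<n. bs ! p)" unfolding tstnz_iff_nth lbs ..
    also have "\<dots> \<longleftrightarrow> (\<exists>i\<in>{1..n}. bs ! (i - 1))"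
      using ex_less_shift[of n "\<lambda>i. bs ! (i - 1)"] by simp
    finally have tz: "tstnz bs \<longleftrightarrow> (\<exists>i\<in>{1..n}. s (InReg i))" using inp by (metis (lifting))
    have "yields X 0 s (tstnz bs)"
    proof (cases "tstnz bs")
      case False
      have "exec X 0 s s" by (rule miss[OF start]) (use False tz in auto)
      then show ?thesis using out False by (auto simp: yields_def)
    next
      case True
      then obtain j where "j \<in> {1..n}" "s (InReg j)" using tz by auto
      then obtain i where i: "i \<in> {1..n}" "s (InReg i)" "0 \<le> r i"
        "\<And>k. k \<in> {1..n} \<Longrightarrow> 0 \<le> r k \<Longrightarrow> r k < r i \<Longrightarrow> \<not> s (InReg k)"
        using first_hit[of j s 0] by (metis le0)
      define c where "c = (if 0 < special_input X \<and> s (InReg (nat (special_input X))) then nat (special_input X) else 0)"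
      have y0: "yields X 0 (test_store i c) True" using unit[OF i(1)] unit'[OF i(1)] by (auto simp: c_def)
      have "yields X 0 (test_store i c) True \<longleftrightarrow> yields X (entry i) (test_store i c) True"
      proof (rule yields_hit[of i "test_store i c" 0, OF i(1) _ start])
        fix k assume k: "k \<in> {1..n}" "0 \<le> r k" "r k < r i"
        then have "\<not> s (InReg k)" using i(4) by blast
        moreover have "c = k \<Longrightarrow> k \<noteq> 0 \<Longrightarrow> s (InReg k)" by (auto simp: c_def split: if_splits)
        ultimately show "\<not> test_store i c (InReg k)" using k by auto
      qed (use i in auto)
      then have yc: "yields X (entry i) (test_store i c) True" using y0 by simp
      have "yields X (entry i) s True"
      proof (rule yields_from_E[OF _ i(1) _ i(2) _ c_def unit_entry[OF i(1)] yc])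
        fix p j assume p: "p < length X" and u: "X ! p = PosTest (AuxGet j) \<or> X ! p = NegTest (AuxGet j)"
        have "valid_prim (X ! p)" using valid p by simp
        then have "1 \<le> j" using u by (elim disjE) simp_all
        then show "\<not> s (AuxReg j)" using k[OF p u] aux by simp
      qed (use entry[OF i(1)] in simp_all)
      then show ?thesis using yields_hit[of i s 0 True] i start True by simp
    qed
    then show "\<exists>s'. exec X 0 s s' \<and> s' OutReg = tstnz bs" by (auto simp: yields_def)
  qed
qed

end

lemma (in passing) ex_block_structure: "\<exists>r E \<tau>. block_structure X n r E \<tau>"
proof -
  obtain s' where s': "exec X 0 (test_store 0 0) s'" "\<not> s' OutReg"
    using zero by (auto simp: yields_def)
  obtain T ps ss where t: "ps 0 = 0" "ss 0 = test_store 0 0" "ss T = s'" "ps T < length X" "X ! ps T = Term"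
    "\<forall>k<T. X ! ps k \<noteq> Term \<and> ps k < ps (Suc k) \<and>
       next_state (X ! ps k) (ps k, ss k) = (ps (Suc k), ss (Suc k))"
    using exec_trace[OF s'(1)] by blast
  interpret zero_trace X n T ps ss
    by unfold_locales (use t s' in auto)
  show ?thesis using blocks by blast
qed

lemma passes_imp_computes:
  assumes X: "X \<in> IS" "length X = L n" and p: "passes X n"
  shows "computes X n tstnz"
proof -
  have "passing X n" by unfold_locales (use p X in \<open>auto simp: passes_def\<close>)
  then obtain r E \<tau> where "block_structure X n r E \<tau>" using passing.ex_block_structure by blast
  then interpret block_structure X n r E \<tau> .
  interpret passing_blocks X n r E \<tau>
    by unfold_locales (use p X in \<open>auto simp: passes_def IS_def\<close>)
  show ?thesis by (rule computes_tstnz)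
qed

lemma computes_imp_passes:
  assumes "computes X n tstnz"
  shows "passes X n"
proof -
  obtain k where k: "\<And>bs s. length bs = n \<Longrightarrow> \<forall>i \<in> {1..n}. s (InReg i) = bs ! (i - 1) \<Longrightarrow>
       s OutReg = False \<Longrightarrow> \<forall>i \<in> {1..k}. s (AuxReg i) = False \<Longrightarrow>
       \<exists>s'. exec X 0 s s' \<and> s' OutReg = tstnz bs"
    using assms unfolding computes_def by blast
  have main: "yields X 0 (test_store i c) (\<exists>j\<in>{1..n}. j = i \<or> j = c)" for i c
  proof -
    let ?bs = "map (\<lambda>j. Suc j = i \<or> Suc j = c) [0..<n]"
    have "\<exists>s'. exec X 0 (test_store i c) s' \<and> s' OutReg = tstnz ?bs"
      by (rule k) auto
    moreover have "tstnz ?bs \<longleftrightarrow> (\<exists>j<n. Suc j = i \<or> Suc j = c)"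
      unfolding tstnz_iff_nth by auto
    moreover have "\<dots> \<longleftrightarrow> (\<exists>j\<in>{1..n}. j = i \<or> j = c)"
      by (rule ex_less_shift)
    ultimately show ?thesis by (simp add: yields_def)
  qed
  have T: "yields X 0 (test_store i c) True" if "i \<in> {1..n}" for i c
  proof -
    have "(\<exists>j\<in>{1..n}. j = i \<or> j = c) = True" using that by auto
    then show ?thesis using main[of i c] by simp
  qed
  have "(\<exists>j\<in>{1..n}. j = 0 \<or> j = (0::nat)) = False" by auto
  then have "yields X 0 (test_store 0 0) False" using main[of 0 0] by simp
  then show ?thesis using T by (auto simp: passes_def)
qed

section \<open>The random access machine\<close>

text \<open>Cells: 0 and 2 hold the constants 0 and 1, 6 holds \<open>n\<close>, 7 the end address of the stored
  sequence, 8 the address of the current instruction, 9 the unit vector \<open>i\<close>, 11 a stamp that is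
  increased for every run, 12--18 are scratch, and 72 holds the second index \<open>c\<close>. The instruction at
  position \<open>p\<close> has its form in cell \<open>200 + 4p\<close> and its parameter in \<open>201 + 4p\<close>; \<open>in:j\<close> is cell
  \<open>202 + 4j\<close>, \<open>aux:j\<close> is cell \<open>207 + 4j\<close>, and \<open>out\<close> is cell 203, that is, \<open>aux\<close> with the parameter
  \<open>-1\<close> by which \<open>out\<close> instructions are encoded. A register holds 1 iff its cell contains the
  current stamp, so raising the stamp resets all of them at once. While reading, the parameter
  preceding each form is written to cell 60 plus the sum of the two adjacent forms; thus cell 72
  ends up with the parameter for the last sum 12.

  Lines: 0--15 compute the end address, 16--29 read the sequence, 30--41 set up a run, 42--103
  simulate one instruction per iteration (69--95 for basic instructions), 104--114 evaluate the run
  and select the next one, 115 rejects, 117 accepts.\<close>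

definition prog :: ram_program where
  "prog = [
     RConst 2 1, RRead 6, RSub 8 6 2, RConst 7 204, RTra 9 2,
     RSub 8 8 2, RSub 8 8 2, RConst 15 12, RAdd 7 7 15, RTra 5 8,
     RAdd 8 8 2, RTra 13 8, RTra 15 2, RConst 15 8, RAdd 7 7 15,
     RConst 8 200,
     RRead 12, RStore 8 12, RConst 15 60, RAdd 15 15 16, RAdd 15 15 12,
     RStore 15 13, RAdd 16 12 0, RRead 13, RAdd 8 8 2, RStore 8 13,
     RConst 15 3, RAdd 8 8 15, RSub 15 7 8, RTra 16 15,
     RAdd 9 6 0, RAdd 11 11 2, RAdd 14 9 9, RAdd 14 14 14, RConst 15 202,
     RAdd 14 14 15, RStore 14 11, RAdd 14 72 72, RAdd 14 14 14, RAdd 14 14 15,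
     RStore 14 11, RConst 8 200,
     RSub 15 7 8, RTra 45 15, RTra 115 2, RLoad 12 8, RAdd 14 8 2,
     RLoad 13 14, RConst 15 17, RSub 15 12 15, RTra 96 15, RAdd 14 13 13,
     RAdd 14 14 14, RConst 17 4, RConst 18 4, RConst 15 11, RSub 15 12 15,
     RTra 62 15, RConst 15 5, RSub 15 12 15, RTra 66 15, RTra 69 2,
     RConst 17 8, RConst 15 12, RSub 12 12 15, RTra 69 2, RConst 18 8,
     RConst 15 6, RSub 12 12 15,
     RTra 73 12, RConst 15 202, RAdd 14 14 15, RTra 89 2, RConst 15 207,
     RAdd 14 14 15, RConst 15 3, RSub 15 12 15, RTra 82 15, RConst 15 2,
     RSub 15 12 15, RTra 89 15, RTra 83 2, RAdd 12 15 0, RSub 15 12 2,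
     RTra 87 15, RStore 14 0, RTra 94 2, RStore 14 11, RTra 92 2,
     RLoad 15 14, RSub 15 11 15, RTra 94 15, RAdd 8 8 17, RTra 42 2,
     RAdd 8 8 18, RTra 42 2,
     RSub 15 15 2, RTra 104 15, RTra 100 13, RTra 115 2, RAdd 14 13 13,
     RAdd 14 14 14, RAdd 8 8 14, RTra 42 2,
     RSub 15 11 203, RTra 108 9, RTra 117 15, RTra 115 2, RTra 115 15,
     RSub 9 9 2, RTra 31 9, RTra 113 72, RTra 31 2, RConst 72 0,
     RTra 30 2, RPrint 0, RTra 118 2, RPrint 2]"

section \<open>Symbolic execution of the program between cut points\<close>

fun code_from :: "ram_program \<Rightarrow> nat \<Rightarrow> ram_program \<Rightarrow> bool" where
  "code_from P k [] \<longleftrightarrow> True"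
| "code_from P k (x # xs) \<longleftrightarrow> P ! k = x \<and> code_from P (k + 1) xs"

lemma code_from_append: "P = ys @ xs \<Longrightarrow> code_from P (length ys) xs"
proof (induction xs arbitrary: ys)
  case (Cons x xs)
  then show ?case using Cons.IH[of "ys @ [x]"] by simp
qed simp

lemma code_from_0: "P = xs \<Longrightarrow> code_from P 0 xs"
  using code_from_append[of P "[]" xs] by simp

context notes One_nat_def [simp del]
begin

lemmas prog_nth = code_from_0[OF prog_def, simplified]

end

text \<open>Every loop of the program passes through one of these lines, so the code between two of
  them runs for a bounded time and can be evaluated by rewriting.\<close>

definition cuts :: "nat set" where
  "cuts = {9, 16, 30, 31, 42, 69, 104, 111, 115, 117, 118}"

fun run_until :: "nat \<Rightarrow> ram_config \<Rightarrow> ram_config option" where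
  "run_until 0 \<sigma> = (if ram_pc \<sigma> \<in> cuts then Some \<sigma> else None)"
| "run_until (Suc t) \<sigma> =
     (if ram_pc \<sigma> \<in> cuts then Some \<sigma> else Option.bind (ram_step prog \<sigma>) (run_until t))"

text \<open>The first step is unconditional because a segment may start at a cut, where
  \<open>run_until\<close> would stop at once.\<close>

definition segment :: "nat \<Rightarrow> ram_config \<Rightarrow> ram_config option" where
  "segment t \<sigma> = Option.bind (ram_step prog \<sigma>) (run_until t)"

definition reach :: "nat \<Rightarrow> ram_config \<Rightarrow> ram_config \<Rightarrow> bool" where
  "reach t \<sigma> \<sigma>' \<longleftrightarrow> (\<exists>u\<le>t. ram_steps prog u \<sigma> = Some \<sigma>')"

lemma reach_step: "ram_step prog \<sigma> = Some \<sigma>1 \<Longrightarrow> reach t \<sigma>1 \<sigma>' \<Longrightarrow> reach (Suc t) \<sigma> \<sigma>'"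
  unfolding reach_def by (metis bind.bind_lunit not_less_eq_eq ram_steps.simps(2))

lemma reach_refl: "reach t \<sigma> \<sigma>"
  unfolding reach_def by (intro exI[of _ 0]) simp

lemma run_until_reach: "run_until t \<sigma> = Some \<sigma>' \<Longrightarrow> reach t \<sigma> \<sigma>'"
proof (induction t arbitrary: \<sigma>)
  case (Suc t)
  then show ?case
    by (auto simp: reach_refl bind_eq_Some_conv split: if_splits intro: reach_step)
qed (auto simp: reach_refl split: if_splits)

lemma segment_reach: "segment t \<sigma> = Some \<sigma>' \<Longrightarrow> reach (Suc t) \<sigma> \<sigma>'"
  by (auto simp: segment_def bind_eq_Some_conv intro: reach_step run_until_reach)

lemma ram_steps_add: "ram_steps P (a + b) \<sigma> = Option.bind (ram_steps P a \<sigma>) (ram_steps P b)"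
  by (induction a arbitrary: \<sigma>) (simp_all, metis bind_assoc)

lemma reach_trans: "reach a \<sigma> \<sigma>' \<Longrightarrow> reach b \<sigma>' \<sigma>'' \<Longrightarrow> a + b \<le> c \<Longrightarrow> reach c \<sigma> \<sigma>''"
proof -
  assume "reach a \<sigma> \<sigma>'" "reach b \<sigma>' \<sigma>''" "a + b \<le> c"
  then obtain u v where "u \<le> a" "v \<le> b" "ram_steps prog u \<sigma> = Some \<sigma>'" "ram_steps prog v \<sigma>' = Some \<sigma>''"
    by (auto simp: reach_def)
  then have "u + v \<le> c" "ram_steps prog (u + v) \<sigma> = Some \<sigma>''"
    using \<open>a + b \<le> c\<close> by (auto simp: ram_steps_add)
  then show ?thesis unfolding reach_def by blast
qed

lemma reach_mono: "reach a \<sigma> \<sigma>' \<Longrightarrow> a \<le> c \<Longrightarrow> reach c \<sigma> \<sigma>'"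
  using reach_trans[OF _ reach_refl[of 0]] by simp

abbreviation config :: "nat \<Rightarrow> (nat \<Rightarrow> int) \<Rightarrow> int list \<Rightarrow> int list \<Rightarrow> ram_config" where
  "config pc m xs ys \<equiv> \<lparr>ram_pc = pc, ram_mem = m, ram_inp = xs, ram_out = ys\<rparr>"

lemma run_until_numeral:
  "run_until (numeral k) \<sigma> = (if ram_pc \<sigma> \<in> cuts then Some \<sigma>
     else Option.bind (ram_step prog \<sigma>) (run_until (pred_numeral k)))"
  by (simp add: numeral_eq_Suc)

lemma ram_step_prog:
  "ram_step prog \<sigma> = (if ram_pc \<sigma> < 118 then ram_exec (prog ! ram_pc \<sigma>) \<sigma> else None)"
  by (simp add: ram_step_def prog_def)

lemmas symbolic = segment_def run_until_numeral ram_step_prog prog_nth cuts_def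

subsection \<open>Simulation of one instruction\<close>

text \<open>Addresses modulo 4 separate forms, parameters, inputs and auxiliary registers, so large
  register numbers never hit the stored sequence. No register cell exceeds the stamp; the bound
  starts at 198, the cell \<open>202 + 4 * c\<close> for \<open>c = - 1\<close>.\<close>

definition machine :: "nat \<Rightarrow> prim list \<Rightarrow> int \<Rightarrow> (nat \<Rightarrow> int) \<Rightarrow> bool" where
  "machine n X c m \<longleftrightarrow> m 0 = 0 \<and> m 2 = 1 \<and> m 6 = int n \<and> m 7 = 200 + 4 * int (length X) \<and>
     m 72 = c \<and> 0 \<le> m 11 \<and>
     (\<forall>p<length X. m (200 + 4 * p) = prim_form (X ! p) \<and> m (201 + 4 * p) = prim_param (X ! p)) \<and>
     (\<forall>x\<ge>198. 2 \<le> x mod 4 \<longrightarrow> m x \<le> m 11)"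

text \<open>\<open>0 < m 11\<close> keeps a written 0 distinct from the stamp. The bound
  \<open>j\<ge>1\<close> leaves out cell 202, which is marked when an index is 0.\<close>

definition represents :: "(nat \<Rightarrow> int) \<Rightarrow> store \<Rightarrow> bool" where
  "represents m s \<longleftrightarrow> 0 < m 11 \<and> (s OutReg \<longleftrightarrow> m 203 = m 11) \<and>
     (\<forall>j\<ge>1. (s (InReg j) \<longleftrightarrow> m (202 + 4 * j) = m 11) \<and>
        (s (AuxReg j) \<longleftrightarrow> m (207 + 4 * j) = m 11))"

fun write_back :: "basic \<Rightarrow> (nat \<Rightarrow> int) \<Rightarrow> nat \<Rightarrow> int" where
  "write_back (OutSet b) m = m(203 := if b then m 11 else 0)"
| "write_back (AuxSet j b) m = m(207 + 4 * j := if b then m 11 else 0)"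
| "write_back (InGet j) m = m"
| "write_back (AuxGet j) m = m"

lemma machine_cong:
  assumes "machine n X c m" "\<And>x. x \<notin> {8, 9} \<union> {12..18} \<Longrightarrow> m' x = m x"
  shows "machine n X c m'"
  using assms unfolding machine_def by (auto simp: assms(2))

lemma represents_cong:
  assumes "represents m s" "\<And>x. x \<notin> {8, 9} \<union> {12..18} \<Longrightarrow> m' x = m x"
  shows "represents m' s"
  using assms unfolding represents_def by (auto simp: assms(2))

lemma machine_wr:
  assumes "machine n X c m"
  shows "machine n X c (write_back a m)"
proof -
  have *: "machine n X c (m(y := v))" if "203 \<le> y" "y mod 4 = 3" "v \<le> m 11" for y v
  proof -
    have "y \<noteq> 200 + 4 * p" "y \<noteq> 201 + 4 * p" for p using that(2) by presburger+
    then show ?thesis using assms that unfolding machine_def by auto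
  qed
  have "(207 + 4 * j) mod 4 = 3" for j :: nat by presburger
  moreover have "0 \<le> m 11" using assms by (simp add: machine_def)
  ultimately show ?thesis using assms by (cases a) (simp_all add: *)
qed

lemma represents_wr:
  assumes "represents m s"
  shows "represents (write_back a m) (effect a s)"
proof -
  have *: "202 + 4 * j \<noteq> 207 + 4 * (k :: nat)" "202 + 4 * j \<noteq> (203 :: nat)" for j k by presburger+
  show ?thesis using assms * *(1)[symmetric] unfolding represents_def by (cases a) auto
qed

lemma nat_addr [simp]:
  "nat (200 + 4 * int p) = 200 + 4 * p" "nat (201 + 4 * int p) = 201 + 4 * p"
  "nat (202 + 4 * int p) = 202 + 4 * p" "nat (207 + 4 * int p) = 207 + 4 * p"
  "nat (4 * int p + 202) = 202 + 4 * p" "nat (4 * int p + 207) = 207 + 4 * p"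
  by simp_all

text \<open>\<open>k\<close> is 0 for plain instructions, 1 for positive and 2 for negative tests;
  cells 17 and 18 receive the address increments for reply 1 and reply 0.\<close>

lemma decode:
  assumes "m 2 = 1" "m 7 = 200 + 4 * int l" "m 8 = 200 + 4 * int p" "p < l"
    and "m (200 + 4 * p) = 6 * k + b" "m (201 + 4 * p) = a" "0 \<le> b" "b < 6" "k \<in> {0, 1, 2}"
  shows "\<exists>m'. segment 40 (config 42 m xs ys) = Some (config 69 m' xs ys) \<and>
    m' 12 = b \<and> m' 14 = 4 * a \<and> m' 17 = (if k = 2 then 8 else 4) \<and>
    m' 18 = (if k = 1 then 8 else 4) \<and> (\<forall>x. x \<notin> {12..18} \<longrightarrow> m' x = m x)"
proof -
  consider "k = 0" | "k = 1" | "k = 2" using assms(9) by blast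
  then show ?thesis
    by cases (use assms in \<open>simp_all add: symbolic\<close>)
qed

lemma exec_basic:
  assumes "machine n X c m" "represents m s" "valid_basic a"
    and "m 12 = basic_form a" "m 14 = 4 * basic_param a" "m 17 = d" "m 18 = d'"
  shows "\<exists>m'. segment 30 (config 69 m xs ys) = Some (config 42 m' xs ys) \<and>
    m' 8 = m 8 + (if reply a s then d else d') \<and> (\<forall>x. x \<notin> {8} \<union> {12..18} \<longrightarrow> m' x = write_back a m x)"
proof -
  have m: "m 0 = 0" "m 2 = 1" and le: "\<And>x. x \<ge> 198 \<Longrightarrow> 2 \<le> x mod 4 \<Longrightarrow> m x \<le> m 11"
    using assms(1) by (auto simp: machine_def)
  show ?thesis
  proof (cases a)
    case (InGet j)
    \<comment> \<open>The machine can only test for \<open>> 0\<close>; as contents never exceed the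
      stamp, this decides equality with it.\<close>
    have "m (202 + 4 * j) \<le> m 11" by (rule le) (simp, presburger)
    moreover have "reply a s \<longleftrightarrow> m (202 + 4 * j) = m 11" using assms(2,3) InGet by (simp add: represents_def)
    ultimately show ?thesis using assms(4-) m InGet
      by (cases "reply a s") (simp_all add: symbolic)
  next
    case (AuxGet j)
    have "m (207 + 4 * j) \<le> m 11" by (rule le) (simp, presburger)
    moreover have "reply a s \<longleftrightarrow> m (207 + 4 * j) = m 11" using assms(2,3) AuxGet by (simp add: represents_def)
    ultimately show ?thesis using assms(4-) m AuxGet
      by (cases "reply a s") (simp_all add: symbolic)
  next
    case (OutSet b)
    then show ?thesis using assms(4-) m
      by (cases b) (simp_all add: symbolic)
  next
    case (AuxSet j b)
    then show ?thesis using assms(4-) m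
      by (cases b) (simp_all add: symbolic)
  qed
qed

lemma exec_tested:
  assumes "machine n X c m" "represents m s" "m 8 = 200 + 4 * int p" "p < length X"
    and "valid_basic a" "prim_form (X ! p) = 6 * k + basic_form a" "k \<in> {0, 1, 2}"
    and "prim_param (X ! p) = basic_param a"
  shows "\<exists>m'. reach 72 (config 42 m xs ys) (config 42 m' xs ys) \<and> machine n X c m' \<and>
    represents m' (effect a s) \<and> m' 9 = m 9 \<and>
    m' 8 = m 8 + (if reply a s then if k = 2 then 8 else 4 else if k = 1 then 8 else 4)"
proof -
  have m: "m 2 = 1" "m 7 = 200 + 4 * int (length X)"
    "m (200 + 4 * p) = 6 * k + basic_form a" "m (201 + 4 * p) = basic_param a"
    using assms unfolding machine_def by auto
  have b: "0 \<le> basic_form a" "basic_form a < 6" by (cases a; simp)+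
  obtain m1 where m1: "segment 40 (config 42 m xs ys) = Some (config 69 m1 xs ys)"
    "m1 12 = basic_form a" "m1 14 = 4 * basic_param a" "m1 17 = (if k = 2 then 8 else 4)"
    "m1 18 = (if k = 1 then 8 else 4)" "\<And>x. x \<notin> {12..18} \<Longrightarrow> m1 x = m x"
    using decode[OF m(1,2) assms(3,4) m(3,4) b assms(7)] by blast
  have mach: "machine n X c m1" by (rule machine_cong[OF assms(1)]) (use m1(6) in simp)
  have rep1: "represents m1 s" by (rule represents_cong[OF assms(2)]) (use m1(6) in simp)
  obtain m2 where m2: "segment 30 (config 69 m1 xs ys) = Some (config 42 m2 xs ys)"
    "m2 8 = m1 8 + (if reply a s then m1 17 else m1 18)"
    "\<And>x. x \<notin> {8} \<union> {12..18} \<Longrightarrow> m2 x = write_back a m1 x"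
    using exec_basic[OF mach rep1 assms(5) m1(2,3) refl refl] by blast
  have "reach 72 (config 42 m xs ys) (config 42 m2 xs ys)"
    by (rule reach_trans[OF segment_reach[OF m1(1)] segment_reach[OF m2(1)]]) simp
  moreover have "machine n X c m2"
    by (rule machine_cong[OF machine_wr[OF mach, of a]]) (use m2(3) in simp)
  moreover have "represents m2 (effect a s)"
    by (rule represents_cong[OF represents_wr[OF rep1, of a]]) (use m2(3) in simp)
  moreover have "write_back a m1 9 = m1 9" by (cases a) auto
  then have "m2 9 = m 9" using m2(3)[of 9] m1(6)[of 9] by simp
  ultimately show ?thesis using m2(2) m1(4,5) m1(6)[of 8] by (intro exI[of _ m2]) simp
qed

lemma sim_next_state:
  assumes "machine n X c m" "represents m s" "m 8 = 200 + 4 * int p" "p < length X"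
    and "valid_prim (X ! p)" "X ! p \<noteq> Term" "X ! p \<noteq> Jump 0" "next_state (X ! p) (p, s) = (p', s')"
  shows "\<exists>m'. reach 72 (config 42 m xs ys) (config 42 m' xs ys) \<and> machine n X c m' \<and>
    represents m' s' \<and> m' 9 = m 9 \<and> m' 8 = 200 + 4 * int p'"
proof (cases "X ! p")
  case (Plain a)
  then show ?thesis using exec_tested[OF assms(1-4), of a 0 xs ys] assms(3,5,8) by auto
next
  case (PosTest a)
  then show ?thesis using exec_tested[OF assms(1-4), of a 1 xs ys] assms(3,5,8) by (auto split: if_splits)
next
  case (NegTest a)
  then show ?thesis using exec_tested[OF assms(1-4), of a 2 xs ys] assms(3,5,8) by (auto split: if_splits)
next
  case (Jump l)
  have l: "0 < l" using Jump assms(7) by (cases l) auto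
  have m: "m 2 = 1" "m 7 = 200 + 4 * int (length X)" "m (200 + 4 * p) = 18" "m (201 + 4 * p) = int l"
    using assms(1,4) Jump unfolding machine_def by auto
  have "\<exists>m'. segment 40 (config 42 m xs ys) = Some (config 42 m' xs ys) \<and> m' 8 = 200 + 4 * int p' \<and>
    (\<forall>x. x \<notin> {8} \<union> {12..18} \<longrightarrow> m' x = m x)"
    using m assms(3,4,8) Jump l by (auto simp add: symbolic)
  then obtain m' where m': "segment 40 (config 42 m xs ys) = Some (config 42 m' xs ys)" "m' 8 = 200 + 4 * int p'"
    "\<And>x. x \<notin> {8} \<union> {12..18} \<Longrightarrow> m' x = m x" by blast
  have "reach 72 (config 42 m xs ys) (config 42 m' xs ys)"
    using reach_mono[OF segment_reach[OF m'(1)]] by simp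
  moreover have "machine n X c m'" by (rule machine_cong[OF assms(1)]) (use m'(3) in simp)
  moreover have "represents m' s" by (rule represents_cong[OF assms(2)]) (use m'(3) in simp)
  moreover have "s' = s" using assms(8) Jump by simp
  ultimately show ?thesis using m'(2) m'(3)[of 9] by auto
qed (use assms in simp)

lemma sim_Term:
  assumes "machine n X c m" "represents m s" "m 8 = 200 + 4 * int p" "p < length X" "X ! p = Term"
  shows "\<exists>m'. reach 41 (config 42 m xs ys) (config 104 m' xs ys) \<and> machine n X c m' \<and> represents m' s \<and> m' 9 = m 9"
proof -
  have m: "m 2 = 1" "m 7 = 200 + 4 * int (length X)" "m (200 + 4 * p) = 19" "m (201 + 4 * p) = - 1"
    using assms(1,4,5) unfolding machine_def by auto
  have "\<exists>m'. segment 40 (config 42 m xs ys) = Some (config 104 m' xs ys) \<and>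
    (\<forall>x. x \<notin> {12..18} \<longrightarrow> m' x = m x)"
    using m assms(3,4) by (simp add: symbolic)
  then obtain m' where m': "segment 40 (config 42 m xs ys) = Some (config 104 m' xs ys)"
    "\<And>x. x \<notin> {12..18} \<Longrightarrow> m' x = m x" by blast
  have "reach 41 (config 42 m xs ys) (config 104 m' xs ys)"
    using reach_mono[OF segment_reach[OF m'(1)]] by simp
  moreover have "machine n X c m'" by (rule machine_cong[OF assms(1)]) (use m'(2) in simp)
  moreover have "represents m' s" by (rule represents_cong[OF assms(2)]) (use m'(2) in simp)
  ultimately show ?thesis using m'(2)[of 9] by auto
qed

lemma sim_stuck:
  assumes "machine n X c m" "m 8 = 200 + 4 * int p" "length X \<le> p \<or> X ! p = Jump 0"
  shows "\<exists>m'. reach 41 (config 42 m xs ys) (config 115 m' xs ys) \<and> m' 0 = 0 \<and> m' 2 = 1"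
proof -
  have m: "m 0 = 0" "m 2 = 1" "m 7 = 200 + 4 * int (length X)"
    "p < length X \<Longrightarrow> m (200 + 4 * p) = prim_form (X ! p)"
    "p < length X \<Longrightarrow> m (201 + 4 * p) = prim_param (X ! p)"
    using assms(1) unfolding machine_def by auto
  have "\<exists>m'. segment 40 (config 42 m xs ys) = Some (config 115 m' xs ys) \<and> m' 0 = 0 \<and> m' 2 = 1"
    using m assms(2,3) by (cases "p < length X") (simp_all add: symbolic)
  then show ?thesis using reach_mono[OF segment_reach] by fastforce
qed

text \<open>Apart from \<open>Jump 0\<close> every instruction other than \<open>!\<close> moves
  forward, so non-termination is always noticed. The 72 steps for one instruction are paid by 80 per
  position passed.\<close>

lemma simulation:
  assumes "machine n X c m" "represents m s" "m 8 = 200 + 4 * int p" "\<forall>u \<in> set X. valid_prim u"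
  shows "(\<forall>s'. exec X p s s' \<longrightarrow> (\<exists>m'. reach (80 * (length X - p) + 80) (config 42 m xs ys) (config 104 m' xs ys) \<and>
      machine n X c m' \<and> represents m' s' \<and> m' 9 = m 9)) \<and>
    ((\<nexists>s'. exec X p s s') \<longrightarrow> (\<exists>m'. reach (80 * (length X - p) + 80) (config 42 m xs ys) (config 115 m' xs ys) \<and>
      m' 0 = 0 \<and> m' 2 = 1))"
  using assms
proof (induction "length X - p" arbitrary: p m s rule: less_induct)
  case less
  show ?case
  proof (cases "length X \<le> p \<or> X ! p = Jump 0")
    case True
    obtain m' where m': "reach 41 (config 42 m xs ys) (config 115 m' xs ys)" "m' 0 = 0" "m' 2 = 1"
      using sim_stuck[OF less.prems(1,3) True] by blast
    have "reach (80 * (length X - p) + 80) (config 42 m xs ys) (config 115 m' xs ys)"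
      using reach_mono[OF m'(1)] by simp
    moreover have "\<not> exec X p s s'" for s'
      using True exec_length exec_not_Jump_0 by fastforce
    ultimately show ?thesis using m'(2,3) by blast
  next
    case False
    then have p: "p < length X" and nj: "X ! p \<noteq> Jump 0" by auto
    show ?thesis
    proof (cases "X ! p = Term")
      case True
      obtain m' where m': "reach 41 (config 42 m xs ys) (config 104 m' xs ys)" "machine n X c m'" "represents m' s"
        "m' 9 = m 9" using sim_Term[OF less.prems(1-3) p True] by blast
      have "reach (80 * (length X - p) + 80) (config 42 m xs ys) (config 104 m' xs ys)"
        using reach_mono[OF m'(1)] by simp
      moreover have "exec X p s s' \<longleftrightarrow> s' = s" for s' using p True by (subst exec_unfold) simp
      ultimately show ?thesis using m' by auto
    next
      case nt: False
      obtain p' s1 where n: "next_state (X ! p) (p, s) = (p', s1)" by (metis surj_pair)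
      have "valid_prim (X ! p)" using less.prems(4) p by simp
      then obtain m1 where m1: "reach 72 (config 42 m xs ys) (config 42 m1 xs ys)" "machine n X c m1"
        "represents m1 s1" "m1 9 = m 9" "m1 8 = 200 + 4 * int p'"
        using sim_next_state[OF less.prems(1-3) p _ nt nj n] by blast
      have ex: "exec X p s s' \<longleftrightarrow> exec X p' s1 s'" for s'
        using p nt n by (subst exec_unfold) simp
      have lt: "p < p'" using n nt nj by (cases "X ! p") (auto split: if_splits)
      have le: "72 + (80 * (length X - p') + 80) \<le> 80 * (length X - p) + 80" using lt p by linarith
      have "length X - p' < length X - p" using lt p by linarith
      from less.hyps[OF this m1(2,3,5) less.prems(4)] show ?thesis
        unfolding ex m1(4) using reach_trans[OF m1(1) _ le] by blast
    qed
  qed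
qed

subsection \<open>Running the tests\<close>

text \<open>The raised stamp exceeds the content of every register cell, so exactly the newly marked
  registers hold 1.\<close>

lemma start_test:
  assumes "machine n X c m" "m 9 = int i" "- 1 \<le> c"
  shows "\<exists>m'. reach 31 (config 31 m xs ys) (config 42 m' xs ys) \<and> machine n X c m' \<and>
    represents m' (test_store i (nat c)) \<and> m' 8 = 200 \<and> m' 9 = int i"
proof -
  have m: "m 2 = 1" "m 72 = c" using assms(1) by (auto simp: machine_def)
  have "\<exists>m'. segment 30 (config 31 m xs ys) = Some (config 42 m' xs ys) \<and> m' 8 = 200 \<and> m' 11 = m 11 + 1 \<and>
    (\<forall>x. x \<notin> {8, 11, 14, 15} \<longrightarrow>
      m' x = (if x = 202 + 4 * i \<or> x = nat (202 + 4 * c) then m 11 + 1 else m x))"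
    using m assms(2,3) by (auto simp add: symbolic)
  then obtain m' where m': "segment 30 (config 31 m xs ys) = Some (config 42 m' xs ys)" "m' 8 = 200"
    "m' 11 = m 11 + 1" "\<And>x. x \<notin> {8, 11, 14, 15} \<Longrightarrow>
      m' x = (if x = 202 + 4 * i \<or> x = nat (202 + 4 * c) then m 11 + 1 else m x)" by blast
  have low: "m' x = m x" if "x < 198" "x \<notin> {8, 11, 14, 15}" for x
    using m'(4)[OF that(2)] that(1) assms(3) by auto
  have cells: "m' x = (if x = 202 + 4 * i \<or> int x = 202 + 4 * c then m 11 + 1 else m x)" if "198 \<le> x" for x
    using m'(4)[of x] that assms(3) by auto
  have ns: "200 + 4 * p \<noteq> 202 + 4 * i" "201 + 4 * p \<noteq> 202 + 4 * i"
    "200 + 4 * int p \<noteq> 202 + 4 * c" "201 + 4 * int p \<noteq> 202 + 4 * c"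
    "207 + 4 * p \<noteq> 202 + 4 * i" "207 + 4 * int p \<noteq> 202 + 4 * c"
    "203 \<noteq> 202 + 4 * i" "203 \<noteq> 202 + 4 * c" for p
    by presburger+
  have "machine n X c m'"
    using assms(1) ns unfolding machine_def by (auto simp: low cells m'(3) intro: order_trans)
  moreover have old: "m x \<noteq> m 11 + 1" if "198 \<le> x" "2 \<le> x mod 4" for x
    using assms(1) that unfolding machine_def by fastforce
  have new: "m (202 + 4 * j) \<noteq> m 11 + 1" "m (207 + 4 * j) \<noteq> m 11 + 1" "m 203 \<noteq> m 11 + 1" for j
    by (rule old; presburger)+
  have "represents m' (test_store i (nat c))"
    unfolding represents_def m'(3) using ns new assms(1) by (auto simp: cells machine_def split: if_splits)
  ultimately show ?thesis
    using reach_mono[OF segment_reach[OF m'(1)]] m'(2) low[of 9] assms(2) by auto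
qed

lemma run_test:
  assumes "machine n X c m" "m 9 = int i" "- 1 \<le> c" "\<forall>u \<in> set X. valid_prim u"
  shows "(yields X 0 (test_store i (nat c)) b \<longrightarrow>
      (\<exists>m'. reach (80 * length X + 111) (config 31 m xs ys) (config 104 m' xs ys) \<and> machine n X c m' \<and>
        m' 9 = int i \<and> (b \<longleftrightarrow> m' 203 = m' 11))) \<and>
    (\<not> yields X 0 (test_store i (nat c)) True \<and> \<not> yields X 0 (test_store i (nat c)) False \<longrightarrow>
      (\<exists>m'. reach (80 * length X + 111) (config 31 m xs ys) (config 115 m' xs ys) \<and> m' 0 = 0 \<and> m' 2 = 1))"
proof -
  obtain m1 where m1: "reach 31 (config 31 m xs ys) (config 42 m1 xs ys)" "machine n X c m1"
    "represents m1 (test_store i (nat c))" "m1 8 = 200 + 4 * int 0" "m1 9 = int i"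
    using start_test[OF assms(1-3)] by auto
  have tr: "reach (80 * length X + 111) (config 31 m xs ys) \<sigma>"
    if "reach (80 * (length X - 0) + 80) (config 42 m1 xs ys) \<sigma>" for \<sigma>
    using reach_trans[OF m1(1) that] by simp
  note S = simulation[OF m1(2-4) assms(4), of xs ys]
  show ?thesis
  proof (intro conjI impI)
    assume "yields X 0 (test_store i (nat c)) b"
    then obtain s' where s': "exec X 0 (test_store i (nat c)) s'" "s' OutReg = b" by (auto simp: yields_def)
    then obtain m' where "reach (80 * (length X - 0) + 80) (config 42 m1 xs ys) (config 104 m' xs ys)"
      "machine n X c m'" "represents m' s'" "m' 9 = m1 9" using S by blast
    then show "\<exists>m'. reach (80 * length X + 111) (config 31 m xs ys) (config 104 m' xs ys) \<and>
      machine n X c m' \<and> m' 9 = int i \<and> (b \<longleftrightarrow> m' 203 = m' 11)"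
      using tr m1(5) s'(2) by (auto simp: represents_def)
  next
    assume "\<not> yields X 0 (test_store i (nat c)) True \<and> \<not> yields X 0 (test_store i (nat c)) False"
    then have "\<nexists>s'. exec X 0 (test_store i (nat c)) s'" by (auto simp: yields_def)
    then show "\<exists>m'. reach (80 * length X + 111) (config 31 m xs ys) (config 115 m' xs ys) \<and> m' 0 = 0 \<and> m' 2 = 1"
      using S tr by blast
  qed
qed

lemma verdict:
  assumes "machine n X c m" "m 9 = int i"
  shows "i = 0 \<Longrightarrow> m 203 \<noteq> m 11 \<Longrightarrow>
      \<exists>m'. reach 11 (config 104 m xs ys) (config 117 m' xs ys) \<and> m' 0 = 0 \<and> m' 2 = 1"
    and "(i = 0 \<longleftrightarrow> m 203 = m 11) \<Longrightarrow>
      \<exists>m'. reach 11 (config 104 m xs ys) (config 115 m' xs ys) \<and> m' 0 = 0 \<and> m' 2 = 1"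
    and "0 < i \<Longrightarrow> m 203 = m 11 \<Longrightarrow>
      \<exists>m'. reach 11 (config 104 m xs ys) (config (if i = 1 then 111 else 31) m' xs ys) \<and>
        machine n X c m' \<and> m' 9 = int (i - 1)"
proof -
  have m: "m 0 = 0" "m 2 = 1" "m 203 \<le> m 11" using assms(1) by (auto simp: machine_def)
  show "\<exists>m'. reach 11 (config 104 m xs ys) (config 117 m' xs ys) \<and> m' 0 = 0 \<and> m' 2 = 1"
    if "i = 0" "m 203 \<noteq> m 11"
  proof -
    have "\<exists>m'. segment 10 (config 104 m xs ys) = Some (config 117 m' xs ys) \<and> m' 0 = 0 \<and> m' 2 = 1"
      using m assms(2) that by (simp add: symbolic)
    then show ?thesis using reach_mono[OF segment_reach] by fastforce
  qed
  show "\<exists>m'. reach 11 (config 104 m xs ys) (config 115 m' xs ys) \<and> m' 0 = 0 \<and> m' 2 = 1"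
    if "i = 0 \<longleftrightarrow> m 203 = m 11"
  proof -
    have "\<exists>m'. segment 10 (config 104 m xs ys) = Some (config 115 m' xs ys) \<and> m' 0 = 0 \<and> m' 2 = 1"
      using m assms(2) that by (cases "i = 0") (simp_all add: symbolic)
    then show ?thesis using reach_mono[OF segment_reach] by fastforce
  qed
  show "\<exists>m'. reach 11 (config 104 m xs ys) (config (if i = 1 then 111 else 31) m' xs ys) \<and>
        machine n X c m' \<and> m' 9 = int (i - 1)"
    if "0 < i" "m 203 = m 11"
  proof -
    have "\<exists>m'. segment 10 (config 104 m xs ys) = Some (config (if i = 1 then 111 else 31) m' xs ys) \<and>
        m' 9 = int i - 1 \<and> (\<forall>x. x \<notin> {9, 15} \<longrightarrow> m' x = m x)"
      using m assms(2) that by (cases "i = 1") (simp_all add: symbolic)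
    then obtain m' where m': "segment 10 (config 104 m xs ys) = Some (config (if i = 1 then 111 else 31) m' xs ys)"
      "m' 9 = int i - 1" "\<And>x. x \<notin> {9, 15} \<Longrightarrow> m' x = m x" by blast
    have "machine n X c m'" by (rule machine_cong[OF assms(1)]) (rule m'(3), auto)
    then show ?thesis using reach_mono[OF segment_reach[OF m'(1)], of 11] m'(2) that(1) by auto
  qed
qed

text \<open>Cell 9 counts down from \<open>i\<close>; the 122 consists of 111 for a run and 11 for
  its evaluation.\<close>

lemma unit_tests:
  assumes "machine n X c m" "m 9 = int i" "0 < i" "- 1 \<le> c" "\<forall>u \<in> set X. valid_prim u"
  shows "if \<forall>j\<in>{1..i}. yields X 0 (test_store j (nat c)) True
    then \<exists>m'. reach (i * (80 * length X + 122)) (config 31 m xs ys) (config 111 m' xs ys) \<and>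
      machine n X c m' \<and> m' 9 = 0
    else \<exists>m'. reach (i * (80 * length X + 122)) (config 31 m xs ys) (config 115 m' xs ys) \<and> m' 0 = 0 \<and> m' 2 = 1"
  using assms(1-3)
proof (induction i arbitrary: m)
  case (Suc i)
  let ?B = "80 * length X + 111"
  note run = run_test[OF Suc.prems(1,2) assms(4,5), of _ xs ys]
  have le: "?B + 11 \<le> Suc i * (80 * length X + 122)" "?B \<le> Suc i * (80 * length X + 122)" by simp_all
  consider "yields X 0 (test_store (Suc i) (nat c)) True" | "yields X 0 (test_store (Suc i) (nat c)) False"
    "\<not> yields X 0 (test_store (Suc i) (nat c)) True"
    | "\<not> yields X 0 (test_store (Suc i) (nat c)) True" "\<not> yields X 0 (test_store (Suc i) (nat c)) False" by blast
  then show ?case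
  proof cases
    case 1
    then obtain m1 where m1: "reach ?B (config 31 m xs ys) (config 104 m1 xs ys)" "machine n X c m1"
      "m1 9 = int (Suc i)" "m1 203 = m1 11" using run[of True] by blast
    obtain m2 where m2: "reach 11 (config 104 m1 xs ys) (config (if Suc i = 1 then 111 else 31) m2 xs ys)"
      "machine n X c m2" "m2 9 = int (Suc i - 1)"
      using verdict(3)[OF m1(2,3) _ m1(4)] by blast
    have r: "reach (?B + 11) (config 31 m xs ys) (config (if Suc i = 1 then 111 else 31) m2 xs ys)"
      by (rule reach_trans[OF m1(1) m2(1)]) simp
    show ?thesis
    proof (cases "i = 0")
      case True
      then have "\<forall>j\<in>{1..Suc i}. yields X 0 (test_store j (nat c)) True" using 1 by simp
      moreover have "reach (Suc i * (80 * length X + 122)) (config 31 m xs ys) (config 111 m2 xs ys)"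
        using reach_mono[OF r le(1)] True by simp
      ultimately show ?thesis using m2 True by auto
    next
      case False
      have all: "(\<forall>j\<in>{1..Suc i}. yields X 0 (test_store j (nat c)) True) \<longleftrightarrow>
          (\<forall>j\<in>{1..i}. yields X 0 (test_store j (nat c)) True)"
        using 1 by (auto simp: atLeastAtMostSuc_conv)
      have r': "reach (?B + 11) (config 31 m xs ys) (config 31 m2 xs ys)" using r False by simp
      have tr: "reach (Suc i * (80 * length X + 122)) (config 31 m xs ys) \<sigma>"
        if "reach (i * (80 * length X + 122)) (config 31 m2 xs ys) \<sigma>" for \<sigma>
        by (rule reach_trans[OF r' that]) simp
      have "m2 9 = int i" "0 < i" using m2(3) False by simp_all
      from Suc.IH[OF m2(2) this] show ?thesis
        unfolding all using tr by (auto split: if_splits)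
    qed
  next
    case 2
    then obtain m1 where m1: "reach ?B (config 31 m xs ys) (config 104 m1 xs ys)" "machine n X c m1"
      "m1 9 = int (Suc i)" "m1 203 \<noteq> m1 11" using run[of False] by blast
    obtain m2 where m2: "reach 11 (config 104 m1 xs ys) (config 115 m2 xs ys)" "m2 0 = 0" "m2 2 = 1"
      using verdict(2)[OF m1(2,3)] m1(4) by blast
    have "\<not> (\<forall>j\<in>{1..Suc i}. yields X 0 (test_store j (nat c)) True)" using 2(2) by auto
    then show ?thesis using reach_trans[OF m1(1) m2(1) le(1)] m2(2,3) by auto
  next
    case 3
    then obtain m1 where m1: "reach ?B (config 31 m xs ys) (config 115 m1 xs ys)" "m1 0 = 0" "m1 2 = 1"
      using run[of True] by blast
    have "\<not> (\<forall>j\<in>{1..Suc i}. yields X 0 (test_store j (nat c)) True)" using 3(1) by auto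
    then show ?thesis using reach_mono[OF m1(1) le(2)] m1(2,3) by auto
  qed
qed simp

lemma begin_pass:
  assumes "machine n X c m"
  shows "\<exists>m'. reach 6 (config 30 m xs ys) (config 31 m' xs ys) \<and> machine n X c m' \<and> m' 9 = int n"
proof -
  have m: "m 0 = 0" "m 6 = int n" using assms by (auto simp: machine_def)
  have "\<exists>m'. segment 5 (config 30 m xs ys) = Some (config 31 m' xs ys) \<and> m' 9 = int n \<and>
      (\<forall>x. x \<notin> {9} \<longrightarrow> m' x = m x)"
    using m by (simp add: symbolic)
  then obtain m' where m': "segment 5 (config 30 m xs ys) = Some (config 31 m' xs ys)" "m' 9 = int n"
    "\<And>x. x \<notin> {9} \<Longrightarrow> m' x = m x" by blast
  have "machine n X c m'" by (rule machine_cong[OF assms(1)]) (use m'(3) in simp)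
  then show ?thesis using reach_mono[OF segment_reach[OF m'(1)], of 6] m'(2) by auto
qed

lemma next_pass:
  assumes "machine n X c m" "m 9 = 0"
  shows "0 < c \<Longrightarrow> \<exists>m'. reach 6 (config 111 m xs ys) (config 30 m' xs ys) \<and> machine n X 0 m'"
    and "c \<le> 0 \<Longrightarrow> reach 6 (config 111 m xs ys) (config 31 m xs ys)"
proof -
  have m: "m 2 = 1" "m 72 = c" using assms by (auto simp: machine_def)
  show "reach 6 (config 111 m xs ys) (config 31 m xs ys)" if "c \<le> 0"
    using reach_mono[OF segment_reach, of 5 "config 111 m xs ys" "config 31 m xs ys" 6] m that by (simp add: symbolic)
  show "\<exists>m'. reach 6 (config 111 m xs ys) (config 30 m' xs ys) \<and> machine n X 0 m'" if "0 < c"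
  proof (intro exI conjI)
    show "reach 6 (config 111 m xs ys) (config 30 (m(72 := 0)) xs ys)"
      using reach_mono[OF segment_reach, of 5 "config 111 m xs ys" "config 30 (m(72 := 0)) xs ys" 6] m that
      by (simp add: symbolic)
    show "machine n X 0 (m(72 := 0))" using assms(1) by (auto simp: machine_def)
  qed
qed

text \<open>With \<open>nat c = 0\<close> the countdown runs through the unit vectors. When it
  reaches 0 there is no second index left to clear, and the zero vector is run last.\<close>

lemma final_pass:
  assumes "machine n X c m" "- 1 \<le> c" "c \<le> 0" "0 < n" "\<forall>u \<in> set X. valid_prim u"
  shows "\<exists>m'. reach ((n + 1) * (80 * length X + 122) + 12) (config 30 m xs ys)
    (config (if yields X 0 (test_store 0 0) False \<and> (\<forall>i\<in>{1..n}. yields X 0 (test_store i 0) True) then 117 else 115) m' xs ys) \<and>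
    m' 0 = 0 \<and> m' 2 = 1"
proof -
  let ?W = "80 * length X + 122"
  have c: "nat c = 0" using assms(3) by simp
  obtain m1 where m1: "reach 6 (config 30 m xs ys) (config 31 m1 xs ys)" "machine n X c m1" "m1 9 = int n"
    using begin_pass[OF assms(1)] by blast
  note U = unit_tests[OF m1(2,3) assms(4,2,5), of xs ys, unfolded c]
  show ?thesis
  proof (cases "\<forall>i\<in>{1..n}. yields X 0 (test_store i 0) True")
    case False
    then obtain m2 where m2: "reach (n * ?W) (config 31 m1 xs ys) (config 115 m2 xs ys)" "m2 0 = 0" "m2 2 = 1"
      using U by (auto split: if_splits)
    have "reach ((n + 1) * ?W + 12) (config 30 m xs ys) (config 115 m2 xs ys)"
      by (rule reach_trans[OF m1(1) m2(1)]) simp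
    then show ?thesis using False m2(2,3) by auto
  next
    case True
    then obtain m2 where m2: "reach (n * ?W) (config 31 m1 xs ys) (config 111 m2 xs ys)" "machine n X c m2" "m2 9 = 0"
      using U by (auto split: if_splits)
    have r1: "reach (n * ?W + 6) (config 30 m xs ys) (config 111 m2 xs ys)"
      by (rule reach_trans[OF m1(1) m2(1)]) simp
    have r2: "reach (n * ?W + 12) (config 30 m xs ys) (config 31 m2 xs ys)"
      by (rule reach_trans[OF r1 next_pass(2)[OF m2(2,3) assms(3)]]) simp
    have m29: "m2 9 = int 0" using m2(3) by simp
    note run = run_test[OF m2(2) m29 assms(2,5), of _ xs ys, unfolded c]
    consider "yields X 0 (test_store 0 0) False" | "yields X 0 (test_store 0 0) True" "\<not> yields X 0 (test_store 0 0) False"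
      | "\<not> yields X 0 (test_store 0 0) True" "\<not> yields X 0 (test_store 0 0) False" by blast
    then show ?thesis
    proof cases
      case 1
      then obtain m3 where m3: "reach (80 * length X + 111) (config 31 m2 xs ys) (config 104 m3 xs ys)"
        "machine n X c m3" "m3 9 = int 0" "m3 203 \<noteq> m3 11" using run[of False] by blast
      obtain m4 where m4: "reach 11 (config 104 m3 xs ys) (config 117 m4 xs ys)" "m4 0 = 0" "m4 2 = 1"
        using verdict(1)[OF m3(2,3) refl m3(4)] by blast
      have r3: "reach ?W (config 31 m2 xs ys) (config 117 m4 xs ys)"
        by (rule reach_trans[OF m3(1) m4(1)]) simp
      have "reach ((n + 1) * ?W + 12) (config 30 m xs ys) (config 117 m4 xs ys)"
        by (rule reach_trans[OF r2 r3]) simp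
      then show ?thesis using True 1 m4(2,3) by auto
    next
      case 2
      then obtain m3 where m3: "reach (80 * length X + 111) (config 31 m2 xs ys) (config 104 m3 xs ys)"
        "machine n X c m3" "m3 9 = int 0" "m3 203 = m3 11" using run[of True] by blast
      obtain m4 where m4: "reach 11 (config 104 m3 xs ys) (config 115 m4 xs ys)" "m4 0 = 0" "m4 2 = 1"
        using verdict(2)[OF m3(2,3)] m3(4) by blast
      have r3: "reach ?W (config 31 m2 xs ys) (config 115 m4 xs ys)"
        by (rule reach_trans[OF m3(1) m4(1)]) simp
      have "reach ((n + 1) * ?W + 12) (config 30 m xs ys) (config 115 m4 xs ys)"
        by (rule reach_trans[OF r2 r3]) simp
      then show ?thesis using 2(2) m4(2,3) by auto
    next
      case 3
      then obtain m3 where m3: "reach (80 * length X + 111) (config 31 m2 xs ys) (config 115 m3 xs ys)"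
        "m3 0 = 0" "m3 2 = 1" using run[of True] by blast
      have "reach ((n + 1) * ?W + 12) (config 30 m xs ys) (config 115 m3 xs ys)"
        by (rule reach_trans[OF r2 m3(1)]) simp
      then show ?thesis using 3(2) m3(2,3) by auto
    qed
  qed
qed

text \<open>A positive second index costs one more pass of \<open>n\<close> runs before it is
  cleared: at most \<open>2 * n + 1\<close> runs and four transitions of 6 steps.\<close>

lemma all_tests:
  assumes m: "machine n X (special_input X) m" and c: "- 1 \<le> special_input X" and n: "0 < n"
    and valid: "\<forall>u \<in> set X. valid_prim u"
  shows "\<exists>m'. reach ((2 * n + 1) * (80 * length X + 122) + 24) (config 30 m xs ys)
    (config (if passes X n then 117 else 115) m' xs ys) \<and> m' 0 = 0 \<and> m' 2 = 1"
proof (cases "0 < special_input X")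
  case False
  obtain m' where m': "reach ((n + 1) * (80 * length X + 122) + 12) (config 30 m xs ys)
    (config (if passes X n then 117 else 115) m' xs ys)" "m' 0 = 0" "m' 2 = 1"
    using final_pass[OF m c _ n valid] False by (auto simp: passes_def)
  have "(n + 1) * (80 * length X + 122) \<le> (2 * n + 1) * (80 * length X + 122)"
    by (rule mult_right_mono) simp_all
  then have "(n + 1) * (80 * length X + 122) + 12 \<le> (2 * n + 1) * (80 * length X + 122) + 24" by linarith
  from reach_mono[OF m'(1) this] show ?thesis using m'(2,3) by blast
next
  case True
  let ?W = "80 * length X + 122"
  obtain m1 where m1: "reach 6 (config 30 m xs ys) (config 31 m1 xs ys)" "machine n X (special_input X) m1" "m1 9 = int n"
    using begin_pass[OF m] by blast
  note U = unit_tests[OF m1(2,3) n c valid, of xs ys]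
  have eq: "(2 * n + 1) * ?W = n * ?W + (n + 1) * ?W" by (simp add: distrib_right)
  show ?thesis
  proof (cases "\<forall>i\<in>{1..n}. yields X 0 (test_store i (nat (special_input X))) True")
    case False
    then obtain m2 where m2: "reach (n * ?W) (config 31 m1 xs ys) (config 115 m2 xs ys)" "m2 0 = 0" "m2 2 = 1"
      using U by (auto split: if_splits)
    have "reach ((2 * n + 1) * ?W + 24) (config 30 m xs ys) (config 115 m2 xs ys)"
      by (rule reach_trans[OF m1(1) m2(1)]) (use eq in linarith)
    moreover have "\<not> passes X n" using False True by (auto simp: passes_def)
    ultimately show ?thesis using m2(2,3) by auto
  next
    case all: True
    then obtain m2 where m2: "reach (n * ?W) (config 31 m1 xs ys) (config 111 m2 xs ys)"
      "machine n X (special_input X) m2" "m2 9 = 0"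
      using U by (auto split: if_splits)
    obtain m3 where m3: "reach 6 (config 111 m2 xs ys) (config 30 m3 xs ys)" "machine n X 0 m3"
      using next_pass(1)[OF m2(2,3) True] by blast
    have r1: "reach (n * ?W + 6) (config 30 m xs ys) (config 111 m2 xs ys)"
      by (rule reach_trans[OF m1(1) m2(1)]) simp
    have r2: "reach (n * ?W + 12) (config 30 m xs ys) (config 30 m3 xs ys)"
      by (rule reach_trans[OF r1 m3(1)]) simp
    have "passes X n \<longleftrightarrow> yields X 0 (test_store 0 0) False \<and> (\<forall>i\<in>{1..n}. yields X 0 (test_store i 0) True)"
      using all by (auto simp: passes_def)
    then obtain m' where m': "reach ((n + 1) * ?W + 12) (config 30 m3 xs ys)
      (config (if passes X n then 117 else 115) m' xs ys)" "m' 0 = 0" "m' 2 = 1"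
      using final_pass[OF m3(2) _ _ n valid, of xs ys] by auto
    have "reach ((2 * n + 1) * ?W + 24) (config 30 m xs ys) (config (if passes X n then 117 else 115) m' xs ys)"
      by (rule reach_trans[OF r2 m'(1)]) (use eq in linarith)
    then show ?thesis using m'(2,3) by blast
  qed
qed

subsection \<open>Reading the input\<close>

text \<open>\<open>L (k + 2) = L k + 3\<close>, so two inputs add three instructions of 4 cells
  each. \<open>e\<close> already includes the 4 cells for \<open>L 0 = 1\<close>, hence the
  \<open>- 4\<close>.\<close>

lemma compute_length:
  assumes "m 2 = 1" "m 8 = int k - 1" "m 7 = e"
  shows "\<exists>m'. reach (11 * k + 11) (config 9 m xs ys) (config 16 m' xs ys) \<and> m' 8 = 200 \<and>
    m' 7 = e + 4 * int (L k) - 4 \<and> (\<forall>x. x \<notin> {7, 8, 15} \<longrightarrow> m' x = m x)"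
  using assms
proof (induction k arbitrary: m e rule: less_induct)
  case (less k)
  consider "k = 0" | "k = 1" | j where "k = j + 2" by (metis add_2_eq_Suc' not0_implies_Suc One_nat_def)
  then show ?case
  proof cases
    case 1
    then have "\<exists>m'. segment 10 (config 9 m xs ys) = Some (config 16 m' xs ys) \<and> m' 8 = 200 \<and> m' 7 = e \<and>
      (\<forall>x. x \<notin> {7, 8, 15} \<longrightarrow> m' x = m x)"
      using less.prems by (simp add: symbolic)
    then obtain m' where m': "segment 10 (config 9 m xs ys) = Some (config 16 m' xs ys)" "m' 8 = 200" "m' 7 = e"
      "\<forall>x. x \<notin> {7, 8, 15} \<longrightarrow> m' x = m x" by blast
    have "reach (11 * k + 11) (config 9 m xs ys) (config 16 m' xs ys)"
      using reach_mono[OF segment_reach[OF m'(1)]] by simp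
    then show ?thesis using m'(2-4) 1 by (auto simp: L_def)
  next
    case 2
    then have "\<exists>m'. segment 10 (config 9 m xs ys) = Some (config 16 m' xs ys) \<and> m' 8 = 200 \<and> m' 7 = e + 8 \<and>
      (\<forall>x. x \<notin> {7, 8, 15} \<longrightarrow> m' x = m x)"
      using less.prems by (simp add: symbolic)
    then obtain m' where m': "segment 10 (config 9 m xs ys) = Some (config 16 m' xs ys)" "m' 8 = 200" "m' 7 = e + 8"
      "\<forall>x. x \<notin> {7, 8, 15} \<longrightarrow> m' x = m x" by blast
    have "reach (11 * k + 11) (config 9 m xs ys) (config 16 m' xs ys)"
      using reach_mono[OF segment_reach[OF m'(1)]] by simp
    then show ?thesis using m'(2-4) 2 by (auto simp: L_def)
  next
    case 3
    then have "\<exists>m'. segment 10 (config 9 m xs ys) = Some (config 9 m' xs ys) \<and> m' 8 = int j - 1 \<and> m' 7 = e + 12 \<and>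
      (\<forall>x. x \<notin> {7, 8, 15} \<longrightarrow> m' x = m x)"
      using less.prems by (simp add: symbolic)
    then obtain m1 where m1: "segment 10 (config 9 m xs ys) = Some (config 9 m1 xs ys)" "m1 8 = int j - 1" "m1 7 = e + 12"
      "\<forall>x. x \<notin> {7, 8, 15} \<longrightarrow> m1 x = m x" by blast
    have "m1 2 = 1" using m1(4) less.prems(1) by simp
    then obtain m' where m': "reach (11 * j + 11) (config 9 m1 xs ys) (config 16 m' xs ys)" "m' 8 = 200"
      "m' 7 = e + 12 + 4 * int (L j) - 4" "\<forall>x. x \<notin> {7, 8, 15} \<longrightarrow> m' x = m1 x"
      using less.IH[of j m1 "e + 12"] m1(2,3) 3 by auto
    have "reach (11 * k + 11) (config 9 m xs ys) (config 16 m' xs ys)"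
      by (rule reach_trans[OF segment_reach[OF m1(1)] m'(1)]) (use 3 in simp)
    moreover have "L k = L j + 3" using 3 by (simp add: L_eq)
    ultimately show ?thesis using m' m1(4) by auto
  qed
qed

definition listing :: "prim list \<Rightarrow> int list" where
  "listing X = concat (map (\<lambda>u. [prim_form u, prim_param u]) X)"

text \<open>Forms are at most 19, so the cell selected by the sum of two forms lies between 60 and
  98, and it is 72 exactly for the sum 12.\<close>

lemma read_instr:
  assumes "m 0 = 0" "m 2 = 1" "m 7 = 204 + 4 * int p + 4 * int k" "m 8 = 200 + 4 * int p"
    and "m 16 = int f" "f \<le> 19" "m 13 = a" "g \<le> 19"
  shows "\<exists>m'. segment 20 (config 16 m (int g # b # xs) ys) = Some (config (if k = 0 then 30 else 16) m' xs ys) \<and>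
    m' 8 = 204 + 4 * int p \<and> m' 16 = int g \<and> m' 13 = b \<and> m' (200 + 4 * p) = int g \<and> m' (201 + 4 * p) = b \<and>
    m' 72 = (if f + g = 12 then a else m 72) \<and>
    (\<forall>x. x \<notin> {8, 12, 13, 15, 16} \<union> {60..98} \<union> {200 + 4 * p, 201 + 4 * p} \<longrightarrow> m' x = m x)"
proof -
  have [simp]: "nat (60 + int f + int g) = 60 + f + g" by simp
  show ?thesis using assms by (cases "k = 0") (auto simp add: symbolic)
qed

lemma prim_form_nat: "\<exists>g\<le>19. prim_form u = int g"
proof -
  have b: "0 \<le> basic_form a \<and> basic_form a \<le> 5" for a by (cases a) auto
  have "0 \<le> prim_form u \<and> prim_form u \<le> 19"
    using b[of "case u of Plain a \<Rightarrow> a | PosTest a \<Rightarrow> a | NegTest a \<Rightarrow> a"] by (cases u) auto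
  then show ?thesis by (intro exI[of _ "nat (prim_form u)"]) auto
qed

lemma read_program:
  assumes "m 0 = 0" "m 2 = 1" "m 7 = 200 + 4 * int p + 4 * int (length us)" "m 8 = 200 + 4 * int p"
    and "m 16 = int f" "f \<le> 19" "m 13 = a" "us \<noteq> []"
  shows "\<exists>m'. reach (21 * length us) (config 16 m (listing us) ys) (config 30 m' [] ys) \<and>
    m' 72 = scan (m 72) (int f) a us \<and>
    (\<forall>q<length us. m' (200 + 4 * (p + q)) = prim_form (us ! q) \<and> m' (201 + 4 * (p + q)) = prim_param (us ! q)) \<and>
    (\<forall>x. x \<notin> {8, 12, 13, 15, 16} \<union> {60..98} \<and> (x < 200 + 4 * p \<or> 2 \<le> x mod 4) \<longrightarrow> m' x = m x)"
  using assms
proof (induction us arbitrary: m p f a)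
  case (Cons u us)
  obtain g where g: "g \<le> 19" "prim_form u = int g" using prim_form_nat by blast
  have m7: "m 7 = 204 + 4 * int p + 4 * int (length us)" using Cons.prems(3) by simp
  obtain m1 where m1: "segment 20 (config 16 m (int g # prim_param u # listing us) ys) =
      Some (config (if length us = 0 then 30 else 16) m1 (listing us) ys)"
    "m1 8 = 204 + 4 * int p" "m1 16 = int g" "m1 13 = prim_param u" "m1 (200 + 4 * p) = int g"
    "m1 (201 + 4 * p) = prim_param u" "m1 72 = (if f + g = 12 then a else m 72)"
    "\<And>x. x \<notin> {8, 12, 13, 15, 16} \<union> {60..98} \<union> {200 + 4 * p, 201 + 4 * p} \<Longrightarrow> m1 x = m x"
    using read_instr[OF Cons.prems(1,2) m7 Cons.prems(4-7) g(1)] by blast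
  have lst: "listing (u # us) = int g # prim_param u # listing us" by (simp add: listing_def g)
  have r1: "reach 21 (config 16 m (listing (u # us)) ys) (config (if length us = 0 then 30 else 16) m1 (listing us) ys)"
    unfolding lst using reach_mono[OF segment_reach[OF m1(1)]] by simp
  have nm: "200 + 4 * p \<noteq> x" "201 + 4 * p \<noteq> x" if "x < 200 + 4 * p \<or> 2 \<le> x mod 4" for x
    using that by presburger+
  have fr: "m1 x = m x" if "x \<notin> {8, 12, 13, 15, 16} \<union> {60..98} \<and> (x < 200 + 4 * p \<or> 2 \<le> x mod 4)" for x
    using m1(8)[of x] nm[of x] that by auto
  have sc: "scan (m 72) (int f) a (u # us) = scan (m1 72) (int g) (prim_param u) us"
  proof -
    have "int f + int g = 12 \<longleftrightarrow> f + g = 12" by linarith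
    then show ?thesis using m1(7) g(2) by simp
  qed
  show ?case
  proof (cases "us = []")
    case True
    then show ?thesis using r1 m1(5,6) g(2) fr sc by (intro exI[of _ m1]) (auto simp: listing_def)
  next
    case False
    have "\<exists>m'. reach (21 * length us) (config 16 m1 (listing us) ys) (config 30 m' [] ys) \<and>
      m' 72 = scan (m1 72) (int g) (prim_param u) us \<and>
      (\<forall>q<length us. m' (200 + 4 * (p + 1 + q)) = prim_form (us ! q) \<and>
         m' (201 + 4 * (p + 1 + q)) = prim_param (us ! q)) \<and>
      (\<forall>x. x \<notin> {8, 12, 13, 15, 16} \<union> {60..98} \<and> (x < 200 + 4 * (p + 1) \<or> 2 \<le> x mod 4) \<longrightarrow> m' x = m1 x)"
      by (rule Cons.IH) (use m1 Cons.prems fr False g in auto)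
    then obtain m' where m': "reach (21 * length us) (config 16 m1 (listing us) ys) (config 30 m' [] ys)"
      "m' 72 = scan (m1 72) (int g) (prim_param u) us"
      "\<And>q. q < length us \<Longrightarrow> m' (200 + 4 * (p + 1 + q)) = prim_form (us ! q) \<and>
         m' (201 + 4 * (p + 1 + q)) = prim_param (us ! q)"
      "\<And>x. x \<notin> {8, 12, 13, 15, 16} \<union> {60..98} \<Longrightarrow> x < 200 + 4 * (p + 1) \<or> 2 \<le> x mod 4 \<Longrightarrow> m' x = m1 x"
      by blast
    have "reach (21 * length (u # us)) (config 16 m (listing (u # us)) ys) (config 30 m' [] ys)"
      by (rule reach_trans[OF _ m'(1), of 21]) (use r1 False in auto)
    moreover have "m' (200 + 4 * (p + q)) = prim_form ((u # us) ! q) \<and>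
        m' (201 + 4 * (p + q)) = prim_param ((u # us) ! q)" if "q < length (u # us)" for q
    proof (cases q)
      case 0
      then show ?thesis using m'(4)[of "200 + 4 * p"] m'(4)[of "201 + 4 * p"] m1(5,6) g(2) by simp
    next
      case (Suc q')
      then show ?thesis using m'(3)[of q'] that by simp
    qed
    moreover have "m' x = m x"
      if "x \<notin> {8, 12, 13, 15, 16} \<union> {60..98} \<and> (x < 200 + 4 * p \<or> 2 \<le> x mod 4)" for x
      using m'(4)[of x] fr[of x] that by auto
    ultimately show ?thesis using m'(2) sc by auto
  qed
qed simp

text \<open>Parameters are at least -1, which keeps the address \<open>202 + 4 * c\<close> at 198 or
  above.\<close>

lemma scan_ge: "- 1 \<le> c \<Longrightarrow> - 1 \<le> a \<Longrightarrow> - 1 \<le> scan c f a us"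
proof (induction us arbitrary: c f a)
  case (Cons u us)
  have "- 1 \<le> basic_param a" for a by (cases a) auto
  then have "- 1 \<le> prim_param u" by (cases u) auto
  then show ?case using Cons by simp
qed simp

lemma load:
  assumes "length X = L n" "X \<noteq> []"
  shows "\<exists>m. reach (11 * n + 21 * length X + 22) (ram_init (encode_input n X)) (config 30 m [] []) \<and>
    machine n X (special_input X) m"
proof -
  have "\<exists>m. segment 10 (config 0 (\<lambda>_. 0) (int n # listing X) []) = Some (config 9 m (listing X) []) \<and>
    m 2 = 1 \<and> m 6 = int n \<and> m 8 = int n - 1 \<and> m 7 = 204 \<and> (\<forall>x. x \<notin> {2, 6, 7, 8} \<longrightarrow> m x = 0)"
    by (simp add: symbolic del: One_nat_def)
  then obtain m1 where m1: "segment 10 (config 0 (\<lambda>_. 0) (int n # listing X) []) = Some (config 9 m1 (listing X) [])"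
    "m1 2 = 1" "m1 6 = int n" "m1 8 = int n - 1" "m1 7 = 204" "\<And>x. x \<notin> {2, 6, 7, 8} \<Longrightarrow> m1 x = 0" by blast
  obtain m2 where m2: "reach (11 * n + 11) (config 9 m1 (listing X) []) (config 16 m2 (listing X) [])"
    "m2 8 = 200" "m2 7 = 204 + 4 * int (L n) - 4" "\<And>x. x \<notin> {7, 8, 15} \<Longrightarrow> m2 x = m1 x"
    using compute_length[OF m1(2,4,5)] by blast
  have "\<exists>m'. reach (21 * length X) (config 16 m2 (listing X) []) (config 30 m' [] []) \<and>
    m' 72 = scan (m2 72) (int 0) 0 X \<and>
    (\<forall>q<length X. m' (200 + 4 * (0 + q)) = prim_form (X ! q) \<and> m' (201 + 4 * (0 + q)) = prim_param (X ! q)) \<and>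
    (\<forall>x. x \<notin> {8, 12, 13, 15, 16} \<union> {60..98} \<and> (x < 200 + 4 * 0 \<or> 2 \<le> x mod 4) \<longrightarrow> m' x = m2 x)"
    by (rule read_program) (use m1 m2 assms in auto)
  then obtain m3 where m3: "reach (21 * length X) (config 16 m2 (listing X) []) (config 30 m3 [] [])"
    "m3 72 = scan (m2 72) 0 0 X"
    "\<And>q. q < length X \<Longrightarrow> m3 (200 + 4 * q) = prim_form (X ! q) \<and> m3 (201 + 4 * q) = prim_param (X ! q)"
    "\<And>x. x \<notin> {8, 12, 13, 15, 16} \<union> {60..98} \<Longrightarrow> x < 200 \<or> 2 \<le> x mod 4 \<Longrightarrow> m3 x = m2 x" by auto
  have r: "reach (11 * n + 22) (config 0 (\<lambda>_. 0) (int n # listing X) []) (config 16 m2 (listing X) [])"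
    by (rule reach_trans[OF segment_reach[OF m1(1)] m2(1)]) simp
  have "reach (11 * n + 21 * length X + 22) (config 0 (\<lambda>_. 0) (int n # listing X) []) (config 30 m3 [] [])"
    by (rule reach_trans[OF r m3(1)]) simp
  moreover have "machine n X (special_input X) m3"
    using m1 m2 m3 assms(1) unfolding machine_def by (auto simp: special_input_def)
  ultimately show ?thesis by (auto simp: ram_init_def encode_input_def listing_def)
qed

lemma print_answer:
  assumes "m 0 = 0" "m 2 = 1"
  shows "\<exists>m'. reach 5 (config (if b then 117 else 115) m [] []) (config 118 m' [] [if b then 1 else 0])"
proof -
  have "\<exists>m'. segment 4 (config (if b then 117 else 115) m [] []) = Some (config 118 m' [] [if b then 1 else 0])"
    using assms by (cases b) (simp_all add: symbolic)
  then show ?thesis using segment_reach by fastforce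
qed

lemma prog_decides:
  assumes n: "1 \<le> n" and X: "X \<in> IS" "length X = L n"
  shows "ram_outputs_in_time prog (encode_input n X) (3000 * n\<^sup>2) [if passes X n then 1 else 0]"
proof -
  have valid: "X \<noteq> []" "\<forall>u \<in> set X. valid_prim u" using X(1) by (auto simp: IS_def)
  let ?A = "11 * n + 21 * length X + 22" and ?B = "(2 * n + 1) * (80 * length X + 122) + 24"
  obtain m1 where m1: "reach ?A (ram_init (encode_input n X)) (config 30 m1 [] [])" "machine n X (special_input X) m1"
    using load[OF X(2) valid(1)] by blast
  have "- 1 \<le> special_input X" unfolding special_input_def by (rule scan_ge) simp_all
  then obtain m2 where m2: "reach ?B (config 30 m1 [] []) (config (if passes X n then 117 else 115) m2 [] [])"
    "m2 0 = 0" "m2 2 = 1" using all_tests[OF m1(2) _ _ valid(2)] n by (metis Suc_le_eq One_nat_def)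
  obtain m3 where m3: "reach 5 (config (if passes X n then 117 else 115) m2 [] [])
    (config 118 m3 [] [if passes X n then 1 else 0])" using print_answer[OF m2(2,3)] by blast
  have l: "length X \<le> 3 * n" using n X(2) by (simp add: L_eq)
  have sq: "n \<le> n * n" "1 \<le> n * n" using n by auto
  \<comment> \<open>From \<open>1 \<le> n\<close> and \<open>length X \<le> 3 * n\<close>:
    \<open>2 * n + 1 \<le> 3 * n\<close> and
    \<open>80 * length X + 122 \<le> 362 * n\<close>.\<close>
  have "?B \<le> (3 * n) * (362 * n) + 24"
    using n l by (intro add_right_mono mult_mono) auto
  then have "?B \<le> 1086 * (n * n) + 24" by simp
  then have "?A + ?B + 5 \<le> 3000 * n\<^sup>2" using l sq unfolding power2_eq_square by linarith
  then have "reach (3000 * n\<^sup>2) (ram_init (encode_input n X)) (config 118 m3 [] [if passes X n then 1 else 0])"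
    using reach_trans[OF reach_trans[OF m1(1) m2(1) order_refl] m3] by blast
  moreover have "length prog = 118" by (simp add: prog_def)
  ultimately show ?thesis unfolding reach_def ram_outputs_in_time_def by auto
qed

theorem theorem5:
  "\<exists>(P :: ram_program) (T :: nat \<Rightarrow> nat).
     (\<lambda>n. real (T n)) \<in> O(\<lambda>n. (real n)\<^sup>2) \<and>
     (\<forall>n \<ge> 1. \<forall>X \<in> IS. length X = L n \<longrightarrow>
        ram_outputs_in_time P (encode_input n X) (T n)
          [if computes X n tstnz then 1 else 0])"
proof (intro exI conjI allI ballI impI)
  show "(\<lambda>n. real (3000 * n\<^sup>2)) \<in> O(\<lambda>n. (real n)\<^sup>2)" by simp
  fix n X assume A: "1 \<le> n" "X \<in> IS" "length X = L n"
  then have "computes X n tstnz \<longleftrightarrow> passes X n"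
    using passes_imp_computes computes_imp_passes by blast
  then show "ram_outputs_in_time prog (encode_input n X) (3000 * n\<^sup>2) [if computes X n tstnz then 1 else 0]"
    using prog_decides[OF A] by simp
qed

end
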